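(* Let $m\ge3$ be odd and $0\le i\le m-2$. With $\tilde f_m^i,\hat f_m^i,g_m^i$ defined below (and $\tilde f_m^0:=0$), regarded as functions of $(w,z)$ via $s=zw$, $t=z\sqrt{1-w^2}$, the following expansions hold. If $i$ is even ($i=0,2,\dots,m-3$): $$\tilde f_m^i=-i\,2^{m/2-2}\Gamma(\tfrac m2-1)\sum_{j=0}^\infty(4j+m)\frac{(2j+i-1)!!}{(2j+m-i-1)!!}z^{-m/2+1}J_{2j+m/2}(z)C_{2j+1}^{m/2-1}(w),$$ $$\hat f_m^i=(-1)^{(m+1)/2}2^{m/2-1}\Gamma(\tfrac m2-1)\sum_{j=0}^\infty(2j+\tfrac m2-1)\frac{(2j+i-1)!!}{(2j-i+m-3)!!}z^{1-m/2}J_{2j+m/2-1}(z)C_{2j}^{m/2-1}(w),$$ $$g_m^i=2^{m/2-1}\Gamma(\tfrac m2)\sum_{j=0}^\infty(4j+m)\frac{(2j+i-1)!!}{(2j+m-i-1)!!}z^{-m/2}J_{2j+m/2}(z)C_{2j}^{m/2}(w).$$ If $i$ is odd ($i=1,3,\dots,m-2$): $$\tilde f_m^i=-i\,2^{m/2-2}\Gamma(\tfrac m2-1)\sum_{j=0}^\infty(4j+m-2)\frac{(2j+i-2)!!}{(2j+m-i-2)!!}z^{-m/2+1}J_{2j+m/2-1}(z)C_{2j}^{m/2-1}(w),$$ $$\hat f_m^i=-(-1)^{(m+1)/2}2^{m/2-1}\Gamma(\tfrac m2-1)\sum_{j=0}^\infty(2j+\tfrac m2)\frac{(2j+i)!!}{(2j+m-i-2)!!}z^{1-m/2}J_{2j+m/2}(z)C_{2j+1}^{m/2-1}(w),$$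 $$g_m^i=2^{m/2-1}\Gamma(\tfrac m2)\sum_{j=0}^\infty(4j+m+2)\frac{(2j+i)!!}{(2j+m-i)!!}z^{-m/2}J_{2j+m/2+1}(z)C_{2j+1}^{m/2}(w).$$
   Context: For $m$ odd and $i\ge0$: $\tilde f_m^i(s,t)=-\sum_{\ell=0}^{\lfloor (i-1)/2\rfloor}s^{i-1-2\ell}\frac{1}{2^\ell\ell!}\frac{\Gamma(i+1)}{\Gamma(i-2\ell)}\widetilde J_{(m-2\ell-3)/2}(t)$ for $i\ge1$, $\tilde f_m^0:=0$; $\hat f_m^i(s,t)=(-1)^{(m+1)/2+i}\sum_{\ell=0}^{\lfloor i/2\rfloor}s^{i-2\ell}\frac{1}{2^\ell\ell!}\frac{\Gamma(i+1)}{\Gamma(i+1-2\ell)}\widetilde J_{(m-2\ell-3)/2}(t)$; $g_m^i(s,t)=\sum_{\ell=0}^{\lfloor i/2\rfloor}s^{i-2\ell}\frac{1}{2^\ell\ell!}\frac{\Gamma(i+1)}{\Gamma(i+1-2\ell)}\widetilde J_{(m-2\ell-1)/2}(t)$. Here $\widetilde J_\alpha(t)=t^{-\alpha}J_\alpha(t)$, $J_\nu$ Bessel functions, $C_k^\lambda$ Gegenbauer polynomials; double factorials $u!!=u(u-2)\cdots$ down to $1$ or $2$, with $0!!=(-1)!!=1$. In the paper's setting $s=\langle\underline{x},\underline{y}\rangle$, $t=|\underline{x}\wedge\underline{y}|$, $z=|\underline{x}||\underline{y}|$, $w=\langle\underline{x}/|\underline{x}|,\underline{y}/|\underline{y}|\rangle$.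 *)

theory Defs
  imports "HOL-Analysis.Analysis"
begin

text \<open>Bessel function of the first kind (series definition, real order, argument t > 0).\<close>
definition besselJ :: "real \<Rightarrow> real \<Rightarrow> real" where
  "besselJ \<nu> t = (\<Sum>k. (-1)^k * rGamma (real k + \<nu> + 1) / fact k * (t / 2) powr (2 * real k + \<nu>))"

text \<open>Normalized Bessel function t^(-alpha) J_alpha(t), written as its (entire) power series,
  so that it is also defined at t = 0; for t > 0 it equals t powr (-alpha) * besselJ alpha t.\<close>
definition besselJtilde :: "real \<Rightarrow> real \<Rightarrow> real" where
  "besselJtilde \<alpha> t = (\<Sum>k. (-1)^k * rGamma (real k + \<alpha> + 1) / fact k
                          * 2 powr (- (2 * real k + \<alpha>)) * t ^ (2 * k))"

definition gegenbauer :: "nat \<Rightarrow> real \<Rightarrow> real \<Rightarrow> real" where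
  "gegenbauer n lam x = (\<Sum>k\<le>n div 2. (-1)^k * pochhammer lam (n - k)
                        / (fact k * fact (n - 2 * k)) * (2 * x) ^ (n - 2 * k))"

function dfact :: "int \<Rightarrow> real" where
  "dfact u = (if u \<le> 0 then 1 else of_int u * dfact (u - 2))"
  by auto
termination by (relation "Wellfounded.measure (\<lambda>u. nat u)") auto

declare dfact.simps [simp del]

definition ftilde :: "nat \<Rightarrow> nat \<Rightarrow> real \<Rightarrow> real \<Rightarrow> real" where
  "ftilde m i s t = (if i = 0 then 0 else
     - (\<Sum>l\<le>(i - 1) div 2. s ^ (i - 1 - 2 * l) * (1 / (2 ^ l * fact l))
         * (Gamma (real i + 1) / Gamma (real i - 2 * real l))
         * besselJtilde ((real m - 2 * real l - 3) / 2) t))"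

definition fhat :: "nat \<Rightarrow> nat \<Rightarrow> real \<Rightarrow> real \<Rightarrow> real" where
  "fhat m i s t = (-1) ^ ((m + 1) div 2 + i) *
     (\<Sum>l\<le>i div 2. s ^ (i - 2 * l) * (1 / (2 ^ l * fact l))
         * (Gamma (real i + 1) / Gamma (real i + 1 - 2 * real l))
         * besselJtilde ((real m - 2 * real l - 3) / 2) t)"

definition gfun :: "nat \<Rightarrow> nat \<Rightarrow> real \<Rightarrow> real \<Rightarrow> real" where
  "gfun m i s t =
     (\<Sum>l\<le>i div 2. s ^ (i - 2 * l) * (1 / (2 ^ l * fact l))
         * (Gamma (real i + 1) / Gamma (real i + 1 - 2 * real l))
         * besselJtilde ((real m - 2 * real l - 1) / 2) t)"

end

theory Submission
  imports Defs
begin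

text \<open>
  Write \<open>\<lambda> = m/2\<close>. Since \<open>ftilde m i = - i gfun (m-2) (i-1)\<close> and \<open>fhat m i = \<plusminus> gfun (m-2) i\<close>,
  all six expansions are instances of the single expansion
  \<open>gfun m i = 2\<^sup>\<lambda> \<Gamma>(\<lambda>) \<Sum>\<^sub>n (n+\<lambda>) (n+i-1)!!/(n+m-i-1)!! z\<^sup>-\<^sup>\<lambda> J\<^bsub>n+\<lambda>\<^esub>(z) C\<^sub>n\<^sup>\<lambda>(w)\<close>,
  where \<open>n\<close> runs over the naturals with the parity of \<open>i\<close>. It follows by induction on \<open>i\<close> from
  \<open>gfun m (i+1) = s gfun m i + i gfun (m-2) (i-1)\<close>: multiplication by \<open>w\<close> is the three-term recurrence
  of the Gegenbauer polynomials, the passage from \<open>\<lambda>-1\<close> to \<open>\<lambda>\<close> is the connection formula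
  \<open>(n+\<lambda>-1) C\<^sub>n\<^bsup>\<lambda>-1\<^esup> = (\<lambda>-1) (C\<^sub>n\<^sup>\<lambda> - C\<^bsub>n-2\<^esub>\<^sup>\<lambda>)\<close>, and the
  three-term recurrence of the Bessel functions recombines the coefficients. For \<open>i = 0\<close> one compares
  coefficients of powers of \<open>z\<close>, which reduces the claim to the Gegenbauer expansion of \<open>(1-w\<^sup>2)\<^sup>k\<close>.
\<close>

subsection \<open>Gegenbauer polynomials\<close>

text \<open>The extension by zero beyond 2k = n gives sums for different degrees a common range, so
  identities between polynomials can be checked summand by summand.\<close>

definition gegenbauer_term :: "nat \<Rightarrow> real \<Rightarrow> real \<Rightarrow> nat \<Rightarrow> real" where
  "gegenbauer_term n lam x k = (if 2 * k \<le> n then (-1)^k * pochhammer lam (n - k)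
                        / (fact k * fact (n - 2 * k)) * (2 * x) ^ (n - 2 * k) else 0)"

lemma gegenbauer_eq_sum:
  assumes "n div 2 \<le> N"
  shows "gegenbauer n lam x = (\<Sum>k\<le>N. gegenbauer_term n lam x k)"
  unfolding gegenbauer_def gegenbauer_term_def
  by (rule sum.mono_neutral_cong_left) (use assms in auto)

lemma gegenbauer_0 [simp]: "gegenbauer 0 lam x = 1"
  by (simp add: gegenbauer_def)

lemma gegenbauer_1 [simp]: "gegenbauer (Suc 0) lam x = 2 * lam * x"
  by (simp add: gegenbauer_def)

lemma gegenbauer_term_0: "gegenbauer_term n lam x 0 = pochhammer lam n / fact n * (2 * x) ^ n"
  by (simp add: gegenbauer_term_def)

text \<open>The last index is k, not k + 1, because multiplying by X^2 raises the degree by 2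
  without changing the power of x. With n = 2k + a every summand is a multiple of
  \<open>pochhammer (lam + 1) (k + a)\<close> and of x^a.\<close>

lemma gegenbauer_term_lower:
  "gegenbauer_term (Suc (Suc n)) lam x (Suc k) =
     gegenbauer_term (Suc (Suc n)) (lam + 1) x (Suc k)
     - 2 * x * gegenbauer_term (Suc n) (lam + 1) x (Suc k) + gegenbauer_term n (lam + 1) x k"
proof (cases "2 * k \<le> n")
  case True
  then obtain a where n: "n = 2 * k + a"
    using le_Suc_ex by blast
  have *: "pochhammer lam (Suc (k + a)) = lam * pochhammer (lam + 1) (k + a)"
    by (rule pochhammer_rec)
  have 1: "Suc (Suc (2 * k + a)) - Suc k = Suc (k + a)" "Suc (2 * k + a) - Suc k = k + a"
     "2 * k + a - k = k + a" "Suc (Suc (2 * k + a)) - 2 * Suc k = a" "2 * k + a - 2 * k = a"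
     "Suc (2 * k + a) - 2 * Suc k = a - 1"
    by auto
  show ?thesis
  proof (cases a)
    \<comment> \<open>For n = 2k the summand of degree n + 1 at index k + 1 lies outside its range
      and vanishes.\<close>
    case 0
    then show ?thesis
      by (simp add: gegenbauer_term_def n 1 pochhammer_rec[of lam k] pochhammer_Suc[of "lam + 1"]
            divide_simps del: of_nat_Suc)
         (simp add: algebra_simps)
  next
    case (Suc b)
    then show ?thesis
      using *
      by (simp add: gegenbauer_term_def n 1 pochhammer_Suc[of "lam + 1"] divide_simps del: of_nat_Suc)
         (simp add: algebra_simps)
  qed
next
  case False
  then show ?thesis by (auto simp: gegenbauer_term_def)
qed

lemma gegenbauer_term_lower_0:
  "gegenbauer_term (Suc n) lam x 0 =
     gegenbauer_term (Suc n) (lam + 1) x 0 - 2 * x * gegenbauer_term n (lam + 1) x 0"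
  by (simp add: gegenbauer_term_0 pochhammer_rec[of lam n] pochhammer_Suc[of "lam + 1"] divide_simps
         del: of_nat_Suc) (simp add: algebra_simps)

text \<open>Coefficients of \<open>F\<^bsub>\<lambda>\<^esub> = (1 - 2xX + X\<^sup>2) F\<^bsub>\<lambda>+1\<^esub>\<close> for the generating function
  \<open>F\<^bsub>\<lambda>\<^esub> = (1 - 2xX + X\<^sup>2)\<^sup>-\<^sup>\<lambda>\<close>.\<close>
lemma gegenbauer_lower:
  "gegenbauer (Suc (Suc n)) lam x = gegenbauer (Suc (Suc n)) (lam + 1) x
     - 2 * x * gegenbauer (Suc n) (lam + 1) x + gegenbauer n (lam + 1) x"
proof -
  \<comment> \<open>The summand k = 0 is split off because the degree-n polynomial enters with its
    index shifted by one and has no partner there.\<close>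
  have *: "gegenbauer n' lam x = gegenbauer_term n' lam x 0 + (\<Sum>k\<le>n. gegenbauer_term n' lam x (Suc k))"
    if "n' \<in> {Suc n, Suc (Suc n)}" for n' lam
    using that by (subst gegenbauer_eq_sum[of _ "Suc n"]) (auto simp: sum.atMost_Suc_shift simp del: sum.atMost_Suc)
  show ?thesis
    by (simp add: *[of "Suc n"] *[of "Suc (Suc n)"] gegenbauer_eq_sum[of n n]
          gegenbauer_term_lower[of _ lam] gegenbauer_term_lower_0[of _ lam]
          sum.distrib sum_subtractf sum_distrib_left algebra_simps)
qed

lemma gegenbauer_term_deriv:
  "real (Suc (Suc n)) * gegenbauer_term (Suc (Suc n)) lam x (Suc k) =
     2 * lam * (x * gegenbauer_term (Suc n) (lam + 1) x (Suc k) - gegenbauer_term n (lam + 1) x k)"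
proof (cases "2 * k \<le> n")
  case True
  then obtain a where n: "n = 2 * k + a"
    using le_Suc_ex by blast
  have *: "pochhammer lam (Suc (k + a)) = lam * pochhammer (lam + 1) (k + a)"
    by (rule pochhammer_rec)
  have 1: "Suc (Suc (2 * k + a)) - Suc k = Suc (k + a)" "Suc (2 * k + a) - Suc k = k + a"
     "2 * k + a - k = k + a" "Suc (Suc (2 * k + a)) - 2 * Suc k = a" "2 * k + a - 2 * k = a"
     "Suc (2 * k + a) - 2 * Suc k = a - 1"
    by auto
  show ?thesis
  proof (cases a)
    case 0
    then show ?thesis
      by (simp add: gegenbauer_term_def n 1 pochhammer_rec[of lam k] divide_simps del: of_nat_Suc)
         (simp add: algebra_simps)
  next
    case (Suc b)
    then show ?thesis
      using *
      by (simp add: gegenbauer_term_def n 1 divide_simps del: of_nat_Suc) (simp add: algebra_simps)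
  qed
next
  case False
  then show ?thesis by (auto simp: gegenbauer_term_def)
qed

lemma gegenbauer_term_deriv_0:
  "real (Suc n) * gegenbauer_term (Suc n) lam x 0 = 2 * lam * x * gegenbauer_term n (lam + 1) x 0"
  by (simp add: gegenbauer_term_0 pochhammer_rec[of lam n] divide_simps del: of_nat_Suc)

text \<open>Coefficients of \<open>F'\<^bsub>\<lambda>\<^esub> = 2\<lambda>(x - X) F\<^bsub>\<lambda>+1\<^esub>\<close>.\<close>
lemma gegenbauer_generating_deriv:
  "real (Suc (Suc n)) * gegenbauer (Suc (Suc n)) lam x =
     2 * lam * (x * gegenbauer (Suc n) (lam + 1) x - gegenbauer n (lam + 1) x)"
proof -
  have *: "gegenbauer n' lam x = gegenbauer_term n' lam x 0 + (\<Sum>k\<le>n. gegenbauer_term n' lam x (Suc k))"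
    if "n' \<in> {Suc n, Suc (Suc n)}" for n' lam
    using that by (subst gegenbauer_eq_sum[of _ "Suc n"]) (auto simp: sum.atMost_Suc_shift simp del: sum.atMost_Suc)
  have "real (Suc (Suc n)) * gegenbauer (Suc (Suc n)) lam x =
    2 * lam * x * gegenbauer_term (Suc n) (lam + 1) x 0 +
    (\<Sum>k\<le>n. 2 * lam * (x * gegenbauer_term (Suc n) (lam + 1) x (Suc k) - gegenbauer_term n (lam + 1) x k))"
    by (simp only: *[of "Suc (Suc n)"] insert_iff simp_thms distrib_left sum_distrib_left
          gegenbauer_term_deriv gegenbauer_term_deriv_0)
  also have "\<dots> = 2 * lam * (x * gegenbauer (Suc n) (lam + 1) x - gegenbauer n (lam + 1) x)"
    by (simp add: *[of "Suc n"] gegenbauer_eq_sum[of n n] sum_subtractf sum_distrib_left algebra_simps)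
  finally show ?thesis .
qed

text \<open>Adding \<open>lam\<close> times the lowering identity to the derivative identity cancels
  the terms x C_(n+1) with parameter \<open>lam + 1\<close>.\<close>

lemma gegenbauer_connection:
  "(real n + 2 + lam) * gegenbauer (Suc (Suc n)) lam x =
     lam * (gegenbauer (Suc (Suc n)) (lam + 1) x - gegenbauer n (lam + 1) x)"
  using gegenbauer_generating_deriv[of n lam x] arg_cong[OF gegenbauer_lower[of n lam x], of "\<lambda>c. lam * c"]
  by (simp add: algebra_simps)

lemma gegenbauer_connection_low:
  "n < 2 \<Longrightarrow> (real n + lam) * gegenbauer n lam x = lam * gegenbauer n (lam + 1) x"
  by (cases n) (auto simp: less_Suc_eq numeral_2_eq_2 algebra_simps)

text \<open>Here \<open>2 * lam\<close> times the lowering identity is added to the derivative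
  identity, which cancels the lowest-degree term instead.\<close>

lemma gegenbauer_raise:
  "(real n + 1 + 2 * lam) * gegenbauer (Suc n) lam x =
     2 * lam * (gegenbauer (Suc n) (lam + 1) x - x * gegenbauer n (lam + 1) x)"
proof (cases n)
  case (Suc k)
  then show ?thesis
    using gegenbauer_generating_deriv[of k lam x] arg_cong[OF gegenbauer_lower[of k lam x], of "\<lambda>c. 2 * lam * c"]
    by (simp add: algebra_simps)
qed (auto simp: algebra_simps)

text \<open>All three polynomials are rewritten with parameter \<open>lam + 1\<close>: the middle
  one by the connection formula, the top one by the derivative identity, the bottom one by
  \<open>gegenbauer_raise\<close>.\<close>

lemma gegenbauer_rec:
  "2 * (real n + 1 + lam) * x * gegenbauer (Suc n) lam x =
     (real n + 2) * gegenbauer (Suc (Suc n)) lam x + (real n + 2 * lam) * gegenbauer n lam x"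
proof (cases n)
  case 0
  then show ?thesis
    using gegenbauer_generating_deriv[of 0 lam x] by (simp add: algebra_simps)
next
  case (Suc k)
  have "2 * x * ((real k + 2 + lam) * gegenbauer (Suc (Suc k)) lam x) =
       2 * x * (lam * (gegenbauer (Suc (Suc k)) (lam + 1) x - gegenbauer k (lam + 1) x))"
    by (simp only: gegenbauer_connection)
  then show ?thesis
    using gegenbauer_generating_deriv[of "Suc k" lam x] gegenbauer_raise[of k lam x] Suc
    by (simp add: algebra_simps)
qed

text \<open>This trades a factor 1 - x^2 for a parameter lowered by one. The right side is rewritten
  with parameter \<open>lam + 1\<close>; the three-term recurrence there turns the neighbouring
  degrees n - 1 and n + 1 into multiples of x C_n.\<close>

lemma gegenbauer_weight:
  "4 * lam * (real n + lam + 1) * (1 - x\<^sup>2) * gegenbauer n (lam + 1) x =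
     (real n + 2 * lam) * (real n + 2 * lam + 1) * gegenbauer n lam x
     - (real n + 1) * (real n + 2) * gegenbauer (Suc (Suc n)) lam x"
proof (cases n)
  case 0
  then show ?thesis
    using gegenbauer_generating_deriv[of 0 lam x] by (simp add: algebra_simps power2_eq_square)
next
  case (Suc k)
  have 1: "(real n + 2 * lam + 1) * ((real k + 1 + 2 * lam) * gegenbauer (Suc k) lam x) =
     (real n + 2 * lam + 1) * (2 * lam * (gegenbauer (Suc k) (lam + 1) x - x * gegenbauer k (lam + 1) x))"
    by (simp only: gegenbauer_raise)
  have 2: "(real n + 1) * (real (Suc (Suc n)) * gegenbauer (Suc (Suc n)) lam x) =
     (real n + 1) * (2 * lam * (x * gegenbauer (Suc n) (lam + 1) x - gegenbauer n (lam + 1) x))"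
    by (simp only: gegenbauer_generating_deriv)
  have 3: "2 * lam * x * (2 * (real k + 1 + (lam + 1)) * x * gegenbauer (Suc k) (lam + 1) x) =
     2 * lam * x * ((real k + 2) * gegenbauer (Suc (Suc k)) (lam + 1) x + (real k + 2 * (lam + 1)) * gegenbauer k (lam + 1) x)"
    by (simp only: gegenbauer_rec)
  show ?thesis
    using 1 2 3 Suc by (simp add: algebra_simps power2_eq_square)
qed

section \<open>Double factorials and the Gegenbauer expansion of (1 - x^2)^k\<close>

lemma dfact_nonpos: "u \<le> 0 \<Longrightarrow> dfact u = 1"
  by (simp add: dfact.simps)

lemma dfact_rec: "u > 0 \<Longrightarrow> dfact u = of_int u * dfact (u - 2)"
  by (subst dfact.simps) simp

lemma dfact_pos: "dfact u > 0"
proof (induction u rule: dfact.induct)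
  case (1 u)
  then show ?case
    by (cases "u \<le> 0") (auto simp: dfact_nonpos dfact_rec)
qed

lemma dfact_nonzero [simp]: "dfact u \<noteq> 0"
  using dfact_pos[of u] by simp

lemma dfact_even: "dfact (2 * int p) = 2 ^ p * fact p"
proof (induction p)
  case (Suc p)
  then show ?case
    by (subst dfact_rec) (auto simp: algebra_simps)
qed (simp add: dfact_nonpos)

lemma rGamma_Suc_shift: "rGamma (x :: real) = x * rGamma (x + 1)"
  by (simp add: rGamma_plus1)

text \<open>The coefficient of C_(2j) in (1 - x^2)^k, stripped of the factors that do not depend on
  j. In this form it also arises from multiplying \<open>gfun_coeff m 0\<close> with a Bessel series
  and collecting a power of z.\<close>

definition weight_coeff :: "nat \<Rightarrow> nat \<Rightarrow> nat \<Rightarrow> real" where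
  "weight_coeff m k j = (-1) ^ j * (2 * real j + real m / 2) * dfact (2 * int j - 1) / dfact (2 * int j + int m - 1)
     * rGamma (real k + real j + real m / 2 + 1) / fact (k - j)"

text \<open>By induction on \<open>k\<close>: the expansion of \<open>(1-x\<^sup>2)\<^sup>k\<close> with parameter \<open>\<lambda>+1\<close>, multiplied by \<open>1-x\<^sup>2\<close>,
  turns into the expansion of \<open>(1-x\<^sup>2)\<^bsup>k+1\<^esup>\<close> with parameter \<open>\<lambda>\<close>.\<close>
lemma weight_power_expansion:
  assumes "odd m"
  shows "(1 - x\<^sup>2) ^ k = fact k * Gamma (real k + real m / 2 + 1 / 2) * Gamma (real m / 2) * 2 powr (real m / 2 - 1 / 2)
           * (\<Sum>j\<le>k. weight_coeff m k j * gegenbauer (2 * j) (real m / 2) x)"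
  using assms
proof (induction k arbitrary: m)
  case 0
  then obtain p where m: "m = 2 * p + 1" by (rule oddE)
  have pos: "real m / 2 > 0" using m by simp
  have "Gamma (real m / 2 + 1 / 2) = fact p"
  proof -
    have "real m / 2 + 1 / 2 = 1 + real p" by (simp add: m field_simps)
    then show ?thesis using Gamma_fact[of p, where 'a = real] by simp
  qed
  moreover have "2 powr (real m / 2 - 1 / 2) = 2 ^ p"
    by (simp add: m powr_realpow field_simps)
  moreover have "dfact (int m - 1) = 2 ^ p * fact p"
    using dfact_even[of p] by (simp add: m)
  moreover have "Gamma (real m / 2) * (real m / 2) * rGamma (real m / 2 + 1) = 1"
  proof -
    have "Gamma (real m / 2) * rGamma (real m / 2) = 1"
      using Gamma_real_pos[OF pos] by (simp add: rGamma_inverse_Gamma)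
    then show ?thesis
      by (simp only: rGamma_Suc_shift[of "real m / 2"] mult_ac)
  qed
  ultimately show ?case
    by (simp add: weight_coeff_def dfact_nonpos field_simps)
next
  case (Suc k)
  define lam where "lam = real m / 2"
  define K where "K = fact k * Gamma (real k + (lam + 1) + 1 / 2) * Gamma (lam + 1) * 2 powr (lam + 1 - 1 / 2)"
  define K' where "K' = fact (Suc k) * Gamma (real (Suc k) + lam + 1 / 2) * Gamma lam * 2 powr (lam - 1 / 2)"
  define C where "C = (\<lambda>j. gegenbauer (2 * j) lam x)"
  \<comment> \<open>\<open>y j\<close> is \<open>weight_coeff (m + 2) k j\<close> without its factor
    2j + \<open>lam\<close> + 1, which \<open>gegenbauer_weight\<close> consumes.\<close>
  define y where "y = (\<lambda>j. (-1) ^ j * dfact (2 * int j - 1) / dfact (2 * int j + int m + 1)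
     * rGamma (real k + real j + lam + 2) / fact (k - j))"
  \<comment> \<open>\<open>a j\<close> and \<open>b j\<close> are the contributions to C_(2j) from
    the summands of index j and j - 1; each summand feeds two neighbouring degrees.\<close>
  define a where "a = (\<lambda>j. if j \<le> k then y j * (2 * real j + 2 * lam) * (2 * real j + 2 * lam + 1) else 0)"
  define b where "b = (\<lambda>j. if j = 0 then 0 else y (j - 1) * (2 * real j - 1) * (2 * real j))"
  have "m > 0" using Suc.prems by (cases m) auto
  then have lam: "lam > 0" by (simp add: lam_def)
  have KK: "K * (real k + 1) = 2 * lam * K'"
  proof -
    have "2 powr (lam + 1 - 1 / 2) = 2 * 2 powr (lam - 1 / 2)"
      using powr_add[of 2 1 "lam - 1 / 2"] by (simp add: algebra_simps)
    moreover have "Gamma (lam + 1) = lam * Gamma lam"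
      using lam by (intro Gamma_plus1) (auto elim!: nonpos_Ints_cases)
    moreover have "real k + (lam + 1) + 1 / 2 = real (Suc k) + lam + 1 / 2" by simp
    ultimately show ?thesis
      unfolding K_def K'_def by (simp only: fact_Suc of_nat_mult) (simp add: algebra_simps)
  qed
  \<comment> \<open>With \<open>u\<close> factored out this is (2j + 2 lam)(k + 1 - j) + 2j(k + j +
    lam + 1) = 2(k + 1)(2j + lam).\<close>
  have ab: "a j - b j = 2 * (real k + 1) * weight_coeff m (Suc k) j" if "j \<le> Suc k" for j
  proof -
    define u where "u = (-1) ^ j * dfact (2 * int j - 1) / dfact (2 * int j + int m - 1)
                         * rGamma (real k + real j + lam + 2)"
    have w: "weight_coeff m (Suc k) j = u * (2 * real j + lam) / fact (Suc k - j)"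
      by (simp add: weight_coeff_def u_def lam_def add_ac)
    have a: "a j = u * (2 * real j + 2 * lam) * (real (Suc k) - real j) / fact (Suc k - j)"
    proof (cases "j \<le> k")
      case True
      have "dfact (2 * int j + int m + 1) = (2 * real j + 2 * lam + 1) * dfact (2 * int j + int m - 1)"
        by (subst dfact_rec) (auto simp: lam_def)
      moreover have "2 * real j + 2 * lam + 1 \<noteq> 0"
        using lam by (smt (verit) of_nat_0_le_iff)
      ultimately have "a j = u * (2 * real j + 2 * lam) / fact (k - j)"
        using True by (simp add: a_def y_def u_def)
      also have "\<dots> = u * (2 * real j + 2 * lam) * (real (Suc k) - real j) / fact (Suc k - j)"
        using True by (simp add: Suc_diff_le of_nat_diff divide_simps)
      finally show ?thesis .
    next
      case False
      with that have "j = Suc k" by simp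
      then show ?thesis by (simp add: a_def)
    qed
    have b: "b j = - u * (2 * real j) * (real k + real j + lam + 1) / fact (Suc k - j)"
    proof (cases j)
      case (Suc p)
      have 1: "dfact (2 * int j - 1) = (2 * real j - 1) * dfact (2 * int p - 1)"
        by (subst dfact_rec) (auto simp: Suc)
      have 2: "rGamma (real k + real p + lam + 2) = (real k + real j + lam + 1) * rGamma (real k + real j + lam + 2)"
        using rGamma_Suc_shift[of "real k + real p + lam + 2"] by (simp add: Suc add_ac)
      have 3: "2 * int p + int m + 1 = 2 * int j + int m - 1" by (simp add: Suc)
      show ?thesis
        unfolding b_def y_def u_def 1 using 2 3 by (simp add: Suc add_ac mult_ac)
    qed (auto simp: b_def)
    show ?thesis
      unfolding w a b by (simp add: divide_simps) (simp add: algebra_simps)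
  qed
  have step: "4 * lam * (1 - x\<^sup>2) * (weight_coeff (m + 2) k j * gegenbauer (2 * j) (lam + 1) x) =
              y j * (2 * real j + 2 * lam) * (2 * real j + 2 * lam + 1) * C j
               - y j * (2 * real j + 1) * (2 * real j + 2) * C (Suc j)" for j
  proof -
    have "weight_coeff (m + 2) k j = y j * (2 * real j + lam + 1)"
      by (simp add: weight_coeff_def y_def lam_def field_simps)
    then have "4 * lam * (1 - x\<^sup>2) * (weight_coeff (m + 2) k j * gegenbauer (2 * j) (lam + 1) x) =
       y j * (4 * lam * (real (2 * j) + lam + 1) * (1 - x\<^sup>2) * gegenbauer (2 * j) (lam + 1) x)"
      by simp
    then show ?thesis
      unfolding gegenbauer_weight by (simp add: C_def algebra_simps)
  qed
  have "4 * lam * (1 - x\<^sup>2) * (\<Sum>j\<le>k. weight_coeff (m + 2) k j * gegenbauer (2 * j) (lam + 1) x) =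
     (\<Sum>j\<le>k. y j * (2 * real j + 2 * lam) * (2 * real j + 2 * lam + 1) * C j)
      - (\<Sum>j\<le>k. y j * (2 * real j + 1) * (2 * real j + 2) * C (Suc j))"
    unfolding sum_distrib_left step sum_subtractf ..
  also have "(\<Sum>j\<le>k. y j * (2 * real j + 2 * lam) * (2 * real j + 2 * lam + 1) * C j) = (\<Sum>j\<le>Suc k. a j * C j)"
    by (simp add: a_def)
  also have "(\<Sum>j\<le>k. y j * (2 * real j + 1) * (2 * real j + 2) * C (Suc j)) = (\<Sum>j\<le>Suc k. b j * C j)"
    by (subst sum.atMost_Suc_shift) (simp add: b_def algebra_simps)
  also have "(\<Sum>j\<le>Suc k. a j * C j) - (\<Sum>j\<le>Suc k. b j * C j) =
             (\<Sum>j\<le>Suc k. 2 * (real k + 1) * (weight_coeff m (Suc k) j * C j))"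
    unfolding sum_subtractf[symmetric] by (rule sum.cong) (auto simp flip: left_diff_distrib simp: ab)
  also have "\<dots> = 2 * (real k + 1) * (\<Sum>j\<le>Suc k. weight_coeff m (Suc k) j * C j)"
    by (simp only: sum_distrib_left)
  finally have main: "4 * lam * (1 - x\<^sup>2) * (\<Sum>j\<le>k. weight_coeff (m + 2) k j * gegenbauer (2 * j) (lam + 1) x) =
       2 * (real k + 1) * (\<Sum>j\<le>Suc k. weight_coeff m (Suc k) j * C j)" .
  have "real (m + 2) / 2 = lam + 1" by (simp add: lam_def)
  moreover have "odd (m + 2)" using Suc.prems by simp
  ultimately have "(1 - x\<^sup>2) ^ k = K * (\<Sum>j\<le>k. weight_coeff (m + 2) k j * gegenbauer (2 * j) (lam + 1) x)"
    using Suc.IH[of "m + 2"] unfolding K_def by (simp only: not_False_eq_True simp_thms True_implies_equals)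
  then have "4 * lam * (1 - x\<^sup>2) ^ Suc k =
     K * (4 * lam * (1 - x\<^sup>2) * (\<Sum>j\<le>k. weight_coeff (m + 2) k j * gegenbauer (2 * j) (lam + 1) x))"
    by (simp only: power_Suc mult_ac)
  also have "\<dots> = 2 * (K * (real k + 1)) * (\<Sum>j\<le>Suc k. weight_coeff m (Suc k) j * C j)"
    unfolding main by (simp only: mult_ac)
  also have "\<dots> = 4 * lam * (K' * (\<Sum>j\<le>Suc k. weight_coeff m (Suc k) j * C j))"
    unfolding KK by (simp only: mult_ac)
  finally show ?case
    using lam unfolding K'_def C_def lam_def by simp
qed

subsection \<open>Sequences of geometric growth\<close>

text \<open>This is growth that the factorial decay of \<open>bessel_scaled\<close> in n absorbs.
  The condition R \<ge> 1 makes R^n increasing, so the class is stable under backward shifts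
  too.\<close>

definition geometric_growth :: "(nat \<Rightarrow> real) \<Rightarrow> bool" where
  "geometric_growth f \<longleftrightarrow> (\<exists>K R. K \<ge> 0 \<and> R \<ge> 1 \<and> (\<forall>n. \<bar>f n\<bar> \<le> K * R ^ n))"

lemma geometric_growthI:
  "K \<ge> 0 \<Longrightarrow> R \<ge> 1 \<Longrightarrow> (\<And>n. \<bar>f n\<bar> \<le> K * R ^ n) \<Longrightarrow> geometric_growth f"
  unfolding geometric_growth_def by blast

lemma geometric_growth_const: "geometric_growth (\<lambda>_. c)"
  by (rule geometric_growthI[of "\<bar>c\<bar>" 1]) auto

lemma geometric_growth_of_nat: "geometric_growth real"
  by (rule geometric_growthI[of 1 2]) (auto intro: less_imp_le of_nat_less_two_power)

lemma geometric_growth_mult: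
  assumes "geometric_growth f" "geometric_growth g"
  shows "geometric_growth (\<lambda>n. f n * g n)"
proof -
  obtain K R K' R' where K: "K \<ge> 0" "R \<ge> 1" "\<And>n. \<bar>f n\<bar> \<le> K * R ^ n"
     and K': "K' \<ge> 0" "R' \<ge> 1" "\<And>n. \<bar>g n\<bar> \<le> K' * R' ^ n"
    using assms unfolding geometric_growth_def by blast
  show ?thesis
  proof (rule geometric_growthI)
    show "K * K' \<ge> 0" using K K' by simp
    show "R * R' \<ge> 1" using mult_mono[of 1 R 1 R'] K K' by simp
    fix n
    have "\<bar>f n * g n\<bar> \<le> (K * R ^ n) * (K' * R' ^ n)"
      unfolding abs_mult using K K' by (intro mult_mono) auto
    then show "\<bar>f n * g n\<bar> \<le> K * K' * (R * R') ^ n"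
      by (simp add: power_mult_distrib mult_ac)
  qed
qed

lemma geometric_growth_add:
  assumes "geometric_growth f" "geometric_growth g"
  shows "geometric_growth (\<lambda>n. f n + g n)"
proof -
  obtain K R K' R' where K: "K \<ge> 0" "R \<ge> 1" "\<And>n. \<bar>f n\<bar> \<le> K * R ^ n"
     and K': "K' \<ge> 0" "R' \<ge> 1" "\<And>n. \<bar>g n\<bar> \<le> K' * R' ^ n"
    using assms unfolding geometric_growth_def by blast
  show ?thesis
  proof (rule geometric_growthI)
    show "K + K' \<ge> 0" using K K' by simp
    show "max R R' \<ge> 1" using K K' by simp
    fix n
    have "K * R ^ n \<le> K * max R R' ^ n" "K' * R' ^ n \<le> K' * max R R' ^ n"
      using K K' by (auto intro!: mult_left_mono power_mono)
    then show "\<bar>f n + g n\<bar> \<le> (K + K') * max R R' ^ n"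
      using K(3)[of n] K'(3)[of n] by (simp add: algebra_simps)
  qed
qed

lemma geometric_growth_Suc:
  assumes "geometric_growth f"
  shows "geometric_growth (\<lambda>n. f (Suc n))"
proof -
  obtain K R where K: "K \<ge> 0" "R \<ge> 1" "\<And>n. \<bar>f n\<bar> \<le> K * R ^ n"
    using assms unfolding geometric_growth_def by blast
  then show ?thesis
    using K(3)[of "Suc _"] by (intro geometric_growthI[of "K * R" R]) (auto simp: mult_ac)
qed

lemma geometric_growth_pred:
  assumes "geometric_growth f"
  shows "geometric_growth (\<lambda>n. f (n - 1))"
proof -
  obtain K R where K: "K \<ge> 0" "R \<ge> 1" "\<And>n. \<bar>f n\<bar> \<le> K * R ^ n"
    using assms unfolding geometric_growth_def by blast
  have "\<bar>f (n - 1)\<bar> \<le> K * R ^ n" for n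
    by (rule order.trans[OF K(3)]) (use K in \<open>auto intro!: mult_left_mono power_increasing\<close>)
  then show ?thesis using K by (intro geometric_growthI)
qed

text \<open>The base R = A + B + 1 satisfies A R + B \<le> R^2, so the bound reproduces
  itself.\<close>

lemma geometric_growth_rec2:
  assumes "\<And>n. \<bar>f (Suc (Suc n))\<bar> \<le> A * \<bar>f (Suc n)\<bar> + B * \<bar>f n\<bar>" "A \<ge> 0" "B \<ge> 0"
  shows "geometric_growth f"
proof (rule geometric_growthI)
  let ?K = "\<bar>f 0\<bar> + \<bar>f 1\<bar>" and ?R = "A + B + 1"
  show "?K \<ge> 0" "?R \<ge> 1" using assms by auto
  fix n
  show "\<bar>f n\<bar> \<le> ?K * ?R ^ n"
  proof (induction n rule: induct_nat_012)
    case 1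
    have "?K * 1 \<le> ?K * ?R" using assms by (intro mult_left_mono) auto
    then show ?case by simp
  next
    case (ge2 n)
    have "\<bar>f (Suc (Suc n))\<bar> \<le> A * (?K * ?R ^ Suc n) + B * (?K * ?R ^ n)"
      using assms(1)[of n] mult_left_mono[OF ge2(1) assms(3)] mult_left_mono[OF ge2(2) assms(2)] by linarith
    also have "B * (?K * ?R ^ n) \<le> B * (?K * ?R ^ Suc n)"
      using assms by (intro mult_left_mono power_increasing) auto
    also have "A * (?K * ?R ^ Suc n) + B * (?K * ?R ^ Suc n) \<le> ?R * (?K * ?R ^ Suc n)"
      using assms by (simp add: algebra_simps)
    finally show ?case by (simp add: mult_ac)
  qed auto
qed

text \<open>Dividing the three-term recurrence by n + 2 leaves coefficients that are bounded
  uniformly in n.\<close>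

lemma geometric_growth_gegenbauer:
  assumes "\<bar>x\<bar> \<le> 1" "lam \<ge> 0"
  shows "geometric_growth (\<lambda>n. gegenbauer n lam x)"
proof (rule geometric_growth_rec2)
  fix n
  let ?C = "\<lambda>n. gegenbauer n lam x"
  have *: "a / (real n + 2) \<le> b" if "a \<le> b * (real n + 2)" for a b
    using that by (simp add: divide_simps)
  have "?C (Suc (Suc n)) = (2 * (real n + 1 + lam) / (real n + 2) * x) * ?C (Suc n) - ((real n + 2 * lam) / (real n + 2)) * ?C n"
    using gegenbauer_rec[of n lam x] by (simp add: divide_simps)
  also have "\<bar>\<dots>\<bar> \<le> \<bar>2 * (real n + 1 + lam) / (real n + 2) * x\<bar> * \<bar>?C (Suc n)\<bar> + \<bar>(real n + 2 * lam) / (real n + 2)\<bar> * \<bar>?C n\<bar>"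
    unfolding abs_mult[symmetric] by (rule abs_triangle_ineq4)
  also have "\<dots> \<le> ((2 + 2 * lam) * 1) * \<bar>?C (Suc n)\<bar> + (1 + 2 * lam) * \<bar>?C n\<bar>"
  proof (intro add_mono mult_right_mono)
    show "\<bar>2 * (real n + 1 + lam) / (real n + 2) * x\<bar> \<le> (2 + 2 * lam) * 1"
      unfolding abs_mult using assms by (intro mult_mono) (auto intro!: * simp: algebra_simps)
    show "\<bar>(real n + 2 * lam) / (real n + 2)\<bar> \<le> 1 + 2 * lam"
      using assms by (auto intro!: * simp: algebra_simps)
  qed auto
  finally show "\<bar>?C (Suc (Suc n))\<bar> \<le> ((2 + 2 * lam) * 1) * \<bar>?C (Suc n)\<bar> + (1 + 2 * lam) * \<bar>?C n\<bar>" .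
qed (use assms in auto)

subsection \<open>Bessel functions\<close>

lemma pochhammer_ge_fact:
  assumes "(x :: real) \<ge> 1"
  shows "pochhammer x n \<ge> fact n"
proof (induction n)
  case (Suc n)
  have "(x + real n) * pochhammer x n \<ge> (1 + real n) * fact n"
    using assms Suc by (intro mult_mono) auto
  then show ?case by (simp add: pochhammer_Suc mult_ac)
qed auto

text \<open>The quotient of the two values is \<open>pochhammer x n\<close>, which is at least n!
  once x \<ge> 1.\<close>

lemma rGamma_shift_bound:
  assumes "(x :: real) \<ge> 1"
  shows "\<bar>rGamma (x + real n)\<bar> \<le> rGamma x / fact n"
proof -
  have pos: "pochhammer x n \<ge> fact n" by (rule pochhammer_ge_fact[OF assms])
  have "rGamma x > 0"
    using assms Gamma_real_pos[of x] by (simp add: rGamma_inverse_Gamma)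
  moreover have "rGamma (x + real n) = rGamma x / pochhammer x n"
    using pochhammer_rGamma[of x n] pos by (smt (verit) fact_gt_zero nonzero_mult_div_cancel_left)
  ultimately show ?thesis
    using pos less_le_trans[OF fact_gt_zero pos] by (auto intro!: divide_left_mono mult_pos_pos)
qed

text \<open>The factor \<open>z\<^sup>-\<^sup>\<lambda>\<close> removes all non-integral powers of \<open>z\<close>.\<close>
definition bessel_scaled :: "real \<Rightarrow> real \<Rightarrow> nat \<Rightarrow> real" where
  "bessel_scaled lam z n = z powr (- lam) * besselJ (real n + lam) z"

definition bessel_scaled_term :: "real \<Rightarrow> real \<Rightarrow> nat \<Rightarrow> nat \<Rightarrow> real" where
  "bessel_scaled_term lam z n k =
     (-1) ^ k * rGamma (real k + real n + lam + 1) / fact k * (z / 2) ^ (2 * k + n) * 2 powr (- lam)"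

text \<open>Dropping k from (n + k)! separates the variables: the majorant is a function of n times
  a function of k, the shape that \<open>sums_diagonal\<close> requires.\<close>

lemma bessel_scaled_term_bound:
  assumes "lam \<ge> 0" "z > 0"
  shows "\<bar>bessel_scaled_term lam z n k\<bar> \<le>
     2 powr (- lam) * rGamma (lam + 1) * ((z / 2) ^ n / fact n) * (((z / 2)\<^sup>2) ^ k / fact k)"
proof -
  have "\<bar>rGamma (real k + real n + lam + 1)\<bar> \<le> rGamma (lam + 1) / fact (n + k)"
    using rGamma_shift_bound[of "lam + 1" "n + k"] assms by (simp add: add_ac)
  also have "\<dots> \<le> rGamma (lam + 1) / fact n"
    using assms Gamma_real_pos[of "lam + 1"]
    by (intro divide_left_mono) (auto simp: rGamma_inverse_Gamma fact_mono)
  finally have "\<bar>rGamma (real k + real n + lam + 1)\<bar> * ((z / 2) ^ (2 * k + n) * 2 powr (- lam) / fact k) \<le>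
     rGamma (lam + 1) / fact n * ((z / 2) ^ (2 * k + n) * 2 powr (- lam) / fact k)"
    using assms by (intro mult_right_mono) auto
  also have "\<bar>rGamma (real k + real n + lam + 1)\<bar> * ((z / 2) ^ (2 * k + n) * 2 powr (- lam) / fact k)
      = \<bar>bessel_scaled_term lam z n k\<bar>"
    using assms by (simp add: bessel_scaled_term_def abs_mult power_abs)
  finally have "\<bar>bessel_scaled_term lam z n k\<bar> \<le>
     rGamma (lam + 1) / fact n * ((z / 2) ^ (2 * k + n) * 2 powr (- lam) / fact k)" .
  moreover have "(z / 2) ^ (2 * k + n) = ((z / 2)\<^sup>2) ^ k * (z / 2) ^ n"
    by (simp only: power_add power_mult)
  ultimately show ?thesis
    by (simp only: mult_ac times_divide_eq_right times_divide_eq_left divide_divide_eq_left)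
qed

lemma summable_bessel_scaled_term:
  assumes "lam \<ge> 0" "z > 0"
  shows "summable (bessel_scaled_term lam z n)"
proof (rule summable_comparison_test')
  show "summable (\<lambda>k. 2 powr (- lam) * rGamma (lam + 1) * ((z / 2) ^ n / fact n) * (((z / 2)\<^sup>2) ^ k / fact k))"
    using summable_exp[of "(z / 2)\<^sup>2"] by (intro summable_mult) (simp add: field_simps)
qed (use bessel_scaled_term_bound[OF assms] in auto)

lemma besselJ_term_scaled:
  assumes "z > 0"
  shows "z powr (- lam) * ((-1)^k * rGamma (real k + (real n + lam) + 1) / fact k * (z / 2) powr (2 * real k + (real n + lam)))
     = bessel_scaled_term lam z n k"
proof -
  have "(z / 2) powr (2 * real k + (real n + lam)) = (z / 2) powr real (2 * k + n) * (z / 2) powr lam"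
    by (simp flip: powr_add add: add_ac)
  also have "(z / 2) powr lam = z powr lam * 2 powr (- lam)"
    using assms by (simp add: powr_divide powr_minus field_simps)
  also have "(z / 2) powr real (2 * k + n) = (z / 2) ^ (2 * k + n)"
    using assms by (subst powr_realpow) auto
  finally have "(z / 2) powr (2 * real k + (real n + lam)) = (z / 2) ^ (2 * k + n) * (z powr lam * 2 powr (- lam))" .
  moreover have "z powr (- lam) * z powr lam = 1"
    using assms by (simp flip: powr_add)
  ultimately show ?thesis
    by (simp add: bessel_scaled_term_def add_ac mult_ac)
qed

lemma bessel_scaled_sums:
  assumes "lam \<ge> 0" "z > 0"
  shows "bessel_scaled_term lam z n sums bessel_scaled lam z n"
proof -
  let ?b = "\<lambda>k. (-1)^k * rGamma (real k + (real n + lam) + 1) / fact k * (z / 2) powr (2 * real k + (real n + lam))"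
  have b: "?b k = z powr lam * bessel_scaled_term lam z n k" for k
    using assms by (simp flip: besselJ_term_scaled powr_add mult.assoc)
  have "summable ?b"
    unfolding b by (intro summable_mult summable_bessel_scaled_term assms)
  then have "?b sums besselJ (real n + lam) z"
    by (simp add: besselJ_def summable_sums)
  then show ?thesis
    unfolding bessel_scaled_def besselJ_term_scaled[OF assms(2), symmetric] by (rule sums_mult)
qed

text \<open>Summing the majorant over k yields exp((z/2)^2), which does not depend on n.\<close>

lemma bessel_scaled_bound:
  assumes "lam \<ge> 0" "z > 0"
  obtains K where "K \<ge> 0" "\<And>n. \<bar>bessel_scaled lam z n\<bar> \<le> K * ((z / 2) ^ n / fact n)"
proof
  let ?M = "2 powr (- lam) * rGamma (lam + 1)" and ?e = "exp ((z / 2)\<^sup>2)"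
  show "?M * ?e \<ge> 0"
    using assms Gamma_real_pos[of "lam + 1"] by (simp add: rGamma_inverse_Gamma)
  fix n
  have "(\<lambda>k. ?M * ((z / 2) ^ n / fact n) * (((z / 2)\<^sup>2) ^ k / fact k)) sums (?M * ((z / 2) ^ n / fact n) * ?e)"
    using exp_converges[of "(z / 2)\<^sup>2"] by (intro sums_mult) (simp add: field_simps)
  moreover from this have "norm (\<Sum>k. bessel_scaled_term lam z n k) \<le>
      (\<Sum>k. ?M * ((z / 2) ^ n / fact n) * (((z / 2)\<^sup>2) ^ k / fact k))"
    using bessel_scaled_term_bound[OF assms] by (intro norm_suminf_le) (auto simp: sums_iff)
  ultimately have "\<bar>bessel_scaled lam z n\<bar> \<le> ?M * ((z / 2) ^ n / fact n) * ?e"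
    using bessel_scaled_sums[OF assms, of n] by (simp only: sums_iff real_norm_def)
  then show "\<bar>bessel_scaled lam z n\<bar> \<le> ?M * ?e * ((z / 2) ^ n / fact n)"
    by (simp add: mult_ac)
qed

lemma summable_growth_bessel:
  assumes "geometric_growth f" "lam \<ge> 0" "z > 0"
  shows "summable (\<lambda>n. f n * bessel_scaled lam z n)"
proof -
  obtain K where K: "K \<ge> 0" "\<And>n. \<bar>bessel_scaled lam z n\<bar> \<le> K * ((z / 2) ^ n / fact n)"
    by (rule bessel_scaled_bound[OF assms(2,3)]) blast
  obtain A R where A: "A \<ge> 0" "R \<ge> 1" "\<And>n. \<bar>f n\<bar> \<le> A * R ^ n"
    using assms(1) unfolding geometric_growth_def by blast
  show ?thesis
  proof (rule summable_comparison_test')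
    show "summable (\<lambda>n. A * K * ((R * (z / 2)) ^ n / fact n))"
      using summable_exp[of "R * (z / 2)"] by (intro summable_mult) (simp add: field_simps)
    fix n :: nat
    have "\<bar>f n * bessel_scaled lam z n\<bar> \<le> (A * R ^ n) * (K * ((z / 2) ^ n / fact n))"
      unfolding abs_mult using A K by (intro mult_mono) auto
    then show "norm (f n * bessel_scaled lam z n) \<le> A * K * ((R * (z / 2)) ^ n / fact n)"
      by (simp add: power_mult_distrib power_divide mult_ac)
  qed
qed

text \<open>The classical \<open>J\<^bsub>\<nu>-1\<^esub> + J\<^bsub>\<nu>+1\<^esub> = (2\<nu>/z) J\<^sub>\<nu>\<close> for \<open>\<nu> = n + \<lambda> + 1\<close>.\<close>
lemma bessel_scaled_rec:
  assumes "lam \<ge> 0" "z > 0"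
  shows "bessel_scaled lam z n + z * bessel_scaled (lam + 1) z (Suc n) = 2 * (real n + lam + 1) * bessel_scaled (lam + 1) z n"
proof -
  let ?t = "bessel_scaled_term"
  \<comment> \<open>The shift aligns the powers of z/2. In the sum, \<open>rGamma\<close>
    contributes a factor k + n + lam + 1 to the first series and the shifted factorial contributes
    -k, which leaves n + lam + 1.\<close>
  define h where "h = (\<lambda>k. if k = 0 then 0 else z * ?t (lam + 1) z (Suc n) (k - 1))"
  have "h sums (z * bessel_scaled (lam + 1) z (Suc n))"
    using sums_Suc[of h] sums_mult[OF bessel_scaled_sums[of "lam + 1" z "Suc n"], of z] assms
    by (simp add: h_def)
  then have "(\<lambda>k. ?t lam z n k + h k) sums (bessel_scaled lam z n + z * bessel_scaled (lam + 1) z (Suc n))"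
    by (intro sums_add bessel_scaled_sums assms)
  moreover have "?t lam z n k + h k = 2 * (real n + lam + 1) * ?t (lam + 1) z n k" for k
  proof -
    have p: "2 powr (- (lam + 1)) = 2 powr (- lam) / (2 :: real)"
      by (simp add: powr_diff powr_minus divide_simps)
    have g: "rGamma (real k + real n + lam + 1) = (real k + real n + lam + 1) * rGamma (real k + real n + (lam + 1) + 1)"
      by (subst rGamma_Suc_shift) (simp add: add_ac)
    show ?thesis
    proof (cases k)
      case 0
      then show ?thesis
        using g by (simp add: h_def bessel_scaled_term_def p del: minus_add_distrib)
    next
      case (Suc q)
      have "real q + real (Suc n) + (lam + 1) + 1 = real k + real n + (lam + 1) + 1"
        by (simp add: Suc)
      then show ?thesis
        using Suc unfolding h_def bessel_scaled_term_def g p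
        by (simp add: divide_simps del: minus_add_distrib of_nat_Suc)
           (simp add: algebra_simps power2_eq_square)
    qed
  qed
  ultimately show ?thesis
    using sums_mult[OF bessel_scaled_sums[of "lam + 1" z n], of "2 * (real n + lam + 1)"] assms
    by (simp add: sums_iff)
qed

subsection \<open>Series expansions\<close>

text \<open>The product majorant makes the double family absolutely summable, so summation by rows
  and by antidiagonals gives the same value.\<close>

lemma sums_diagonal:
  fixes x :: "nat \<Rightarrow> nat \<Rightarrow> real"
  assumes rows: "\<And>j. x j sums S j"
      and bound: "\<And>j k. \<bar>x j k\<bar> \<le> p j * q k"
      and "summable p" "summable q" "\<And>j. p j \<ge> 0" "\<And>k. q k \<ge> 0"
  shows "S sums (\<Sum>N. \<Sum>j\<le>N. x j (N - j))"
proof -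
  let ?f = "\<lambda>(j, k). x j k"
  have q: "q summable_on UNIV" and p: "p summable_on UNIV"
    using assms by (auto simp: summable_on_UNIV_nonneg_real_iff)
  have "(\<lambda>jk. norm (case jk of (j, k) \<Rightarrow> p j * q k)) summable_on UNIV \<times> UNIV"
    unfolding Infinite_Sum.abs_summable_on_Sigma_iff
  proof (intro conjI ballI)
    fix j
    show "(\<lambda>k. norm (case (j, k) of (j, k) \<Rightarrow> p j * q k)) summable_on UNIV"
      using q assms(5,6) by (auto intro: summable_on_cmult_right)
  next
    have "(\<lambda>j. p j * infsum q UNIV) summable_on UNIV"
      by (intro summable_on_cmult_left p)
    moreover have "infsum q UNIV \<ge> 0"
      using assms by (intro infsum_nonneg) auto
    ultimately show "(\<lambda>j. norm (\<Sum>\<^sub>\<infinity>k. norm (case (j, k) of (j, k) \<Rightarrow> p j * q k))) summable_on UNIV"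
      using assms(5,6) q by (simp add: abs_mult infsum_cmult_right)
  qed
  then have abs: "(\<lambda>jk. norm (?f jk)) summable_on UNIV \<times> UNIV"
    by (rule Infinite_Sum.abs_summable_on_comparison_test) (auto intro: order.trans[OF bound] abs_ge_self)
  then obtain U where U: "(?f has_sum U) (UNIV \<times> UNIV)"
    using Infinite_Sum.abs_summable_summable unfolding summable_on_def by blast
  have "(S has_sum U) UNIV"
  proof (rule has_sum_SigmaD[OF U])
    fix j
    have "summable (\<lambda>k. norm (x j k))"
      using assms by (intro summable_comparison_test'[OF summable_mult[OF \<open>summable q\<close>, of "p j"]]) auto
    then show "((\<lambda>k. ?f (j, k)) has_sum S j) UNIV"
      using norm_summable_imp_has_sum[OF _ rows[of j]] by simp
  qed
  then have SU: "S sums U"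
    by (rule has_sum_imp_sums)
  \<comment> \<open>The bijection sends (j, k) to (j + k, j), so that N = j + k numbers the
    antidiagonals.\<close>
  have "((\<lambda>(N, j). x j (N - j)) has_sum U) (Sigma UNIV (\<lambda>N. {..N}))"
    using U by (rule has_sum_reindex_bij_witness[where i = "\<lambda>(j, k). (j + k, j)" and j = "\<lambda>(N, j). (j, N - j)", THEN iffD2, rotated -1]) auto
  then have "((\<lambda>N. \<Sum>j\<le>N. x j (N - j)) has_sum U) UNIV"
    by (rule has_sum_SigmaD) (auto intro: has_sum_finite)
  then have "(\<lambda>N. \<Sum>j\<le>N. x j (N - j)) sums U"
    by (rule has_sum_imp_sums)
  with SU show ?thesis by (simp add: sums_iff)
qed

text \<open>The zero at degrees of the wrong parity lets the series run over all n, so index shifts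
  in the induction need no case split on parity.\<close>

definition gfun_coeff :: "nat \<Rightarrow> nat \<Rightarrow> nat \<Rightarrow> real" where
  "gfun_coeff m i n =
     (if even (n + i) then dfact (int n + int i - 1) / dfact (int n + int m - int i - 1) else 0)"

text \<open>Two steps in n multiply the coefficient by (n + i + 1)/(n + m - i + 1); since i \<le> m,
  the denominator is at least n + 1 and the ratio at most i + 1.\<close>

lemma geometric_growth_gfun_coeff:
  assumes "i \<le> m"
  shows "geometric_growth (gfun_coeff m i)"
proof (rule geometric_growth_rec2)
  fix n
  show "\<bar>gfun_coeff m i (Suc (Suc n))\<bar> \<le> 0 * \<bar>gfun_coeff m i (Suc n)\<bar> + (real i + 1) * \<bar>gfun_coeff m i n\<bar>"
  proof (cases "even (n + i)")
    case True
    let ?a = "dfact (int n + int i - 1)" and ?b = "dfact (int n + int m - int i - 1)"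
    define c where "c = real n + real m - real i + 1"
    have c: "c > 0" "c \<ge> real n + 1"
      using assms by (auto simp: c_def)
    have "dfact (int (Suc (Suc n)) + int i - 1) = (real n + real i + 1) * ?a"
      by (subst dfact_rec) (auto simp: algebra_simps)
    moreover have "dfact (int (Suc (Suc n)) + int m - int i - 1) = c * ?b"
      using assms by (subst dfact_rec) (auto simp: c_def algebra_simps)
    ultimately have "gfun_coeff m i (Suc (Suc n)) = (real n + real i + 1) / c * gfun_coeff m i n"
      using True by (simp add: gfun_coeff_def)
    moreover have "real n + real i + 1 \<le> (real i + 1) * (real n + 1)"
      by (simp add: algebra_simps)
    then have "real n + real i + 1 \<le> (real i + 1) * c"
      using mult_left_mono[OF c(2), of "real i + 1"] by linarith
    then have "(real n + real i + 1) / c \<le> real i + 1"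
      using c by (simp add: divide_simps)
    ultimately have "\<bar>gfun_coeff m i (Suc (Suc n))\<bar> \<le> (real i + 1) * \<bar>gfun_coeff m i n\<bar>"
      using c by (simp only: abs_mult) (intro mult_right_mono, auto)
    then show ?thesis by simp
  qed (auto simp: gfun_coeff_def)
qed auto

definition gfun_series_term :: "nat \<Rightarrow> nat \<Rightarrow> real \<Rightarrow> real \<Rightarrow> nat \<Rightarrow> real" where
  "gfun_series_term m i z w n = 2 powr (real m / 2) * Gamma (real m / 2) * (real n + real m / 2)
     * gfun_coeff m i n * bessel_scaled (real m / 2) z n * gegenbauer n (real m / 2) w"

lemma sums_even_iff:
  fixes f :: "nat \<Rightarrow> real"
  assumes "\<And>n. odd n \<Longrightarrow> f n = 0"
  shows "(\<lambda>j. f (2 * j)) sums S \<longleftrightarrow> f sums S"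
  by (rule sums_mono_reindex) (use assms in \<open>auto simp: strict_mono_def elim!: evenE\<close>)

lemma sums_odd_iff:
  fixes f :: "nat \<Rightarrow> real"
  assumes "\<And>n. even n \<Longrightarrow> f n = 0"
  shows "(\<lambda>j. f (2 * j + 1)) sums S \<longleftrightarrow> f sums S"
proof (rule sums_mono_reindex)
  fix n :: nat assume n: "n \<notin> range (\<lambda>j. 2 * j + 1)"
  have "even n"
    using n by (metis oddE rangeI)
  then show "f n = 0" by (rule assms)
qed (auto simp: strict_mono_def)

lemma summable_even_index:
  fixes f :: "nat \<Rightarrow> real"
  assumes "summable f" "\<And>n. f n \<ge> 0"
  shows "summable (\<lambda>j. f (2 * j))"
proof -
  have "summable (\<lambda>n. if even n then f n else 0)"
    by (rule summable_comparison_test'[OF assms(1)]) (use assms in auto)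
  then obtain S where "(\<lambda>n. if even n then f n else 0) sums S"
    unfolding summable_def by blast
  then show ?thesis
    by (subst (asm) sums_even_iff[symmetric]) (auto simp: summable_def)
qed

section \<open>The base case i = 0\<close>

lemma gfun_0: "gfun m 0 s t = besselJtilde ((real m - 1) / 2) t"
  by (simp add: gfun_def)

text \<open>Each Bessel function is expanded in powers of z. The antidiagonal sum at z^(2N) is the
  Gegenbauer expansion of (1 - w^2)^N, hence the summand t^(2N) of
  \<open>besselJtilde\<close>.\<close>

lemma gfun_0_expansion:
  assumes "odd m" "z > 0" "\<bar>w\<bar> \<le> 1"
  shows "gfun_series_term m 0 z w sums gfun m 0 s (z * sqrt (1 - w\<^sup>2))"
proof -
  define lam where "lam = real m / 2"
  define kap where "kap = 2 powr lam * Gamma lam"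
  define c where "c = (\<lambda>j. kap * (2 * real j + lam) * (dfact (2 * int j - 1) / dfact (2 * int j + int m - 1)) * gegenbauer (2 * j) lam w)"
  define x where "x = (\<lambda>j k. c j * bessel_scaled_term lam z (2 * j) k)"
  define M where "M = 2 powr (- lam) * rGamma (lam + 1)"
  have "m > 0" using assms by (cases m) auto
  then have lam: "lam > 0" by (simp add: lam_def)
  have G: "Gamma lam > 0" using lam by (rule Gamma_real_pos)
  have "geometric_growth (\<lambda>n. kap * (real n + lam) * gfun_coeff m 0 n * gegenbauer n lam w)"
    using assms lam
    by (intro geometric_growth_mult geometric_growth_add geometric_growth_const geometric_growth_of_nat
          geometric_growth_gfun_coeff geometric_growth_gegenbauer) auto
  then obtain K R where KR: "K \<ge> 0" "R \<ge> 1"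
      "\<And>n. \<bar>kap * (real n + lam) * gfun_coeff m 0 n * gegenbauer n lam w\<bar> \<le> K * R ^ n"
    unfolding geometric_growth_def by blast
  have c: "kap * (real n + lam) * gfun_coeff m 0 n * gegenbauer n lam w = c j" if "n = 2 * j" for n j
    using that by (simp add: c_def gfun_coeff_def)
  \<comment> \<open>\<open>p\<close> consists of the even-indexed terms of the series of exp(R z/2),
    up to a constant, and \<open>q\<close> of the terms of exp((z/2)^2).\<close>
  define p where "p = (\<lambda>j. K * M * ((R * (z / 2)) ^ (2 * j) / fact (2 * j)))"
  define q where "q = (\<lambda>k. ((z / 2)\<^sup>2) ^ k / fact k)"
  have M: "M \<ge> 0"
    using lam Gamma_real_pos[of "lam + 1"] by (simp add: M_def rGamma_inverse_Gamma)
  have "(\<lambda>j. c j * bessel_scaled lam z (2 * j)) sums (\<Sum>N. \<Sum>j\<le>N. x j (N - j))"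
  proof (rule sums_diagonal[where x = x and p = p and q = q])
    show "x j sums (c j * bessel_scaled lam z (2 * j))" for j
      unfolding x_def using lam assms by (intro sums_mult bessel_scaled_sums) auto
    show "summable q"
      unfolding q_def using summable_exp[of "(z / 2)\<^sup>2"] by (simp add: field_simps)
    show "summable p"
      unfolding p_def using summable_exp[of "R * (z / 2)"] KR assms
      by (intro summable_mult summable_even_index[of "\<lambda>n. (R * (z / 2)) ^ n / fact n"]) (auto simp: field_simps)
    show "p j \<ge> 0" "q k \<ge> 0" for j k
      using KR M assms by (auto simp: p_def q_def)
    fix j k
    have "\<bar>x j k\<bar> \<le> (K * R ^ (2 * j)) * (M * ((z / 2) ^ (2 * j) / fact (2 * j)) * q k)"
      unfolding x_def abs_mult M_def q_def using KR(3)[of "2 * j"] c[of "2 * j" j] lam assms KR(1,2)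
      by (intro mult_mono bessel_scaled_term_bound) auto
    also have "\<dots> = p j * q k"
      unfolding p_def power_mult_distrib by (simp only: mult_ac times_divide_eq_right times_divide_eq_left)
    finally show "\<bar>x j k\<bar> \<le> p j * q k" .
  qed
  also have "(\<Sum>N. \<Sum>j\<le>N. x j (N - j)) = gfun m 0 s (z * sqrt (1 - w\<^sup>2))"
  proof -
    let ?t = "z * sqrt (1 - w\<^sup>2)"
    define y where "y = (\<lambda>N. (-1) ^ N * rGamma (real N + (real m - 1) / 2 + 1) / fact N
                          * 2 powr (- (2 * real N + (real m - 1) / 2)) * ?t ^ (2 * N))"
    have diag: "(\<Sum>j\<le>N. x j (N - j)) = y N" for N
    proof -
      \<comment> \<open>The constants of \<open>weight_power_expansion\<close> cancel against those
        of \<open>besselJtilde\<close>: r against G, f against itself, and the powers of 2 leave 1/E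
        = 1/2^(2N).\<close>
      have rearrange: "\<sigma> * r / f * p * T = \<sigma> * g * (Z * e) * W"
        if "V = f * G * g * P * W" "T = Z * V" "r * G = 1" "p * P = 1 / E" "e = 1 / E" "f \<noteq> 0"
        for \<sigma> r f p T g Z e W V G P E :: real
      proof -
        have "\<sigma> * r / f * p * T = \<sigma> * g * (Z * (p * P)) * W * (r * G)"
          using that(6) unfolding that(1,2) by simp
        then show ?thesis using that(3-5) by simp
      qed
      have x: "x j (N - j) = (-1) ^ N * kap * 2 powr (- lam) * (z / 2) ^ (2 * N) * (weight_coeff m N j * gegenbauer (2 * j) lam w)"
        if "j \<le> N" for j
      proof -
        have "(-1 :: real) ^ (N - j) = (-1) ^ N * (-1) ^ j"
          using that by (simp add: minus_one_power_iff)
        moreover have "2 * (N - j) + 2 * j = 2 * N" "real (N - j) + real (2 * j) = real N + real j"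
          using that by auto
        ultimately show ?thesis
          unfolding x_def c_def bessel_scaled_term_def weight_coeff_def lam_def by (simp only:) simp
      qed
      have kap: "kap * 2 powr (- lam) = Gamma lam"
        by (simp add: kap_def powr_minus)
      have sum_x: "(\<Sum>j\<le>N. x j (N - j)) =
         (-1) ^ N * kap * 2 powr (- lam) * (z / 2) ^ (2 * N) * (\<Sum>j\<le>N. weight_coeff m N j * gegenbauer (2 * j) lam w)"
        unfolding sum_distrib_left by (intro sum.cong refl x) auto
      have "(1 - w\<^sup>2) ^ N = fact N * Gamma (real N + lam + 1 / 2) * Gamma lam * 2 powr (lam - 1 / 2)
           * (\<Sum>j\<le>N. weight_coeff m N j * gegenbauer (2 * j) lam w)"
        unfolding lam_def by (rule weight_power_expansion[OF assms(1)])
      moreover have "?t ^ (2 * N) = z ^ (2 * N) * (1 - w\<^sup>2) ^ N"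
        using assms by (simp add: power_mult_distrib power_mult abs_square_le_1)
      moreover have "rGamma (real N + (real m - 1) / 2 + 1) * Gamma (real N + lam + 1 / 2) = 1"
      proof -
        have "real N + (real m - 1) / 2 + 1 = real N + lam + 1 / 2" by (simp add: lam_def field_simps)
        moreover have "Gamma (real N + lam + 1 / 2) > 0" using lam by (intro Gamma_real_pos) auto
        ultimately show ?thesis by (simp only: rGamma_inverse_Gamma) simp
      qed
      moreover have "2 powr (- (2 * real N + (real m - 1) / 2)) * 2 powr (lam - 1 / 2) = 1 / 2 ^ (2 * N)"
      proof -
        have "2 powr (- (2 * real N + (real m - 1) / 2)) * 2 powr (lam - 1 / 2) = 2 powr (- real (2 * N))"
          by (simp flip: powr_add add: lam_def diff_divide_distrib)
        also have "\<dots> = 1 / 2 ^ (2 * N)" by (subst powr_minus, subst powr_realpow) (auto simp: divide_simps)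
        finally show ?thesis .
      qed
      ultimately have "y N = (-1) ^ N * Gamma lam * (z ^ (2 * N) * (1 / 2 ^ (2 * N))) *
          (\<Sum>j\<le>N. weight_coeff m N j * gegenbauer (2 * j) lam w)"
        unfolding y_def by (intro rearrange) (assumption | rule refl fact_nonzero)+
      then show ?thesis
        unfolding sum_x kap[symmetric] by (simp add: power_divide mult_ac)
    qed
    show ?thesis
      unfolding gfun_0 besselJtilde_def diag y_def ..
  qed
  also have "(\<lambda>j. c j * bessel_scaled lam z (2 * j)) = (\<lambda>j. gfun_series_term m 0 z w (2 * j))"
    by (auto simp: c_def gfun_series_term_def gfun_coeff_def kap_def lam_def mult_ac)
  also have "\<dots> sums gfun m 0 s (z * sqrt (1 - w\<^sup>2)) \<longleftrightarrow> gfun_series_term m 0 z w sums gfun m 0 s (z * sqrt (1 - w\<^sup>2))"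
    by (rule sums_even_iff) (auto simp: gfun_series_term_def gfun_coeff_def)
  finally show ?thesis .
qed

section \<open>The recurrence of \<open>gfun\<close> in i\<close>

definition gfun_term :: "nat \<Rightarrow> nat \<Rightarrow> real \<Rightarrow> real \<Rightarrow> nat \<Rightarrow> real" where
  "gfun_term m i s t l = (if 2 * l \<le> i then s ^ (i - 2 * l) * (fact i / (2 ^ l * fact l * fact (i - 2 * l)))
     * besselJtilde ((real m - 2 * real l - 1) / 2) t else 0)"

lemma gfun_eq_sum:
  assumes "i div 2 \<le> N"
  shows "gfun m i s t = (\<Sum>l\<le>N. gfun_term m i s t l)"
proof -
  have "(\<Sum>l\<le>N. gfun_term m i s t l) = (\<Sum>l\<le>i div 2. gfun_term m i s t l)"
    by (rule sum.mono_neutral_right) (use assms in \<open>auto simp: gfun_term_def\<close>)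
  also have "\<dots> = gfun m i s t"
    unfolding gfun_def
  proof (intro sum.cong refl)
    fix l assume "l \<in> {..i div 2}"
    then have l: "2 * l \<le> i" by auto
    then have "real i + 1 - 2 * real l = 1 + real (i - 2 * l)" by (simp add: of_nat_diff)
    then have "Gamma (real i + 1 - 2 * real l) = fact (i - 2 * l)"
      by (simp only: Gamma_fact)
    moreover have "Gamma (real i + 1) = fact i"
      unfolding add.commute[of "real i"] by (rule Gamma_fact)
    ultimately show "gfun_term m i s t l = s ^ (i - 2 * l) * (1 / (2 ^ l * fact l))
         * (Gamma (real i + 1) / Gamma (real i + 1 - 2 * real l)) * besselJtilde ((real m - 2 * real l - 1) / 2) t"
      using l by (simp add: gfun_term_def)
  qed
  finally show ?thesis ..
qed

lemma gfun_term_rec_0: "gfun_term m (Suc i) s t 0 = s * gfun_term m i s t 0"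
  by (simp add: gfun_term_def del: fact_Suc)

text \<open>Powers of s and Bessel orders agree, and i!/(2^l l! (i - 2l)!) counts the sets of l
  disjoint pairs among i points: a new point stays single or is paired with one of the i others. The
  hypothesis keeps m - 2 from being truncated unless the factor i is zero.\<close>

lemma gfun_term_rec:
  assumes "i = 0 \<or> m \<ge> 2"
  shows "gfun_term m (Suc i) s t (Suc l) = s * gfun_term m i s t (Suc l) + real i * gfun_term (m - 2) (i - 1) s t l"
proof (cases "2 * l + 1 \<le> i")
  case True
  then obtain a where i: "i = 2 * l + 1 + a"
    using le_Suc_ex by blast
  have J: "real (m - 2) - 2 * real l - 1 = real m - 2 * real (Suc l) - 1"
    using assms True by (auto simp: of_nat_diff)
  have f: "fact i = real i * fact (i - 1)"
    using i by (subst fact_reduce) auto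
  show ?thesis
  proof (cases a)
    case 0
    then show ?thesis
      using J by (simp add: gfun_term_def i divide_simps del: of_nat_Suc) (simp add: algebra_simps)
  next
    case (Suc b)
    have k: "Suc i - 2 * Suc l = Suc b" "i - 2 * Suc l = b" "i - 1 - 2 * l = Suc b"
      using i Suc by auto
    have c: "2 * Suc l \<le> Suc i" "2 * Suc l \<le> i" "2 * l \<le> i - 1"
      using i Suc by auto
    have s: "real (Suc i) = real (Suc b) + 2 * real (Suc l)"
      using i Suc by simp
    have R: "real i = real b + 2 * real l + 2"
      using i Suc by simp
    have F: "fact (Suc i) = (real (Suc b) + 2 * real (Suc l)) * (real i * fact (i - 1))"
      unfolding fact_Suc of_nat_mult s f ..
    show ?thesis
      unfolding gfun_term_def k J using c
      by (simp add: F f divide_simps del: of_nat_Suc) (simp add: R algebra_simps)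
  qed
qed (auto simp: gfun_term_def)

lemma gfun_Suc:
  assumes "i = 0 \<or> m \<ge> 2"
  shows "gfun m (Suc i) s t = s * gfun m i s t + real i * gfun (m - 2) (i - 1) s t"
proof -
  have *: "gfun m i' s t = gfun_term m i' s t 0 + (\<Sum>l\<le>i. gfun_term m i' s t (Suc l))" if "i' \<in> {i, Suc i}" for i'
    using that by (subst gfun_eq_sum[of _ "Suc i"]) (auto simp: sum.atMost_Suc_shift simp del: sum.atMost_Suc)
  show ?thesis
    unfolding *[of i, simplified] *[of "Suc i", simplified] gfun_term_rec[OF assms] gfun_term_rec_0
    by (subst gfun_eq_sum[of "i - 1" i]) (auto simp: sum.distrib sum_distrib_left distrib_left)
qed

section \<open>Coefficient recurrences and the induction step\<close>

lemma bessel_scaled_Suc: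
  assumes "z > 0"
  shows "bessel_scaled lam z (Suc n) = z * bessel_scaled (lam + 1) z n"
proof -
  have "z * z powr (- (lam + 1)) = z powr (- lam)"
    using assms powr_add[of z 1 "- (lam + 1)"] by simp
  then show ?thesis
    unfolding bessel_scaled_def by (simp add: add_ac flip: mult.assoc)
qed

text \<open>Both quotients on the left equal (n+i-2)!!/(n+m-i-2)!!, and n + i is the missing factor
  of (n+i)!!. Where a natural subtraction truncates, the factor n or i is zero.\<close>

lemma gfun_coeff_Suc:
  assumes "Suc i \<le> m"
  shows "real n * gfun_coeff m i (n - 1) + real i * gfun_coeff (m - 2) (i - 1) n = gfun_coeff m (Suc i) n"
proof (cases "odd (n + i)")
  case True
  let ?q = "dfact (int n + int i - 2) / dfact (int n + int m - int i - 2)"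
  have 1: "real n * gfun_coeff m i (n - 1) = real n * ?q"
  proof (cases n)
    case (Suc k)
    have "int k + int i - 1 = int n + int i - 2" "int k + int m - int i - 1 = int n + int m - int i - 2"
      using Suc by auto
    then show ?thesis using True Suc by (simp only: gfun_coeff_def) (auto simp: algebra_simps)
  qed simp
  have 2: "real i * gfun_coeff (m - 2) (i - 1) n = real i * ?q"
  proof (cases i)
    case (Suc k)
    have "int n + int k - 1 = int n + int i - 2" "int n + int (m - 2) - int k - 1 = int n + int m - int i - 2"
      using Suc assms by auto
    then show ?thesis using True Suc by (simp only: gfun_coeff_def) (auto simp: algebra_simps)
  qed simp
  have "n + i > 0" using True by (cases "n + i") auto
  then have "dfact (int n + int i) = (real n + real i) * dfact (int n + int i - 2)"
    by (subst dfact_rec) auto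
  then have "gfun_coeff m (Suc i) n = (real n + real i) * ?q"
    using True by (simp add: gfun_coeff_def algebra_simps)
  then show ?thesis unfolding 1 2 by (simp only: distrib_right)
next
  case False
  then show ?thesis
    by (cases n; cases i) (auto simp: gfun_coeff_def)
qed

text \<open>Here the common quotient is (n+i)!!/(n+m-i)!!, and n + m - i cancels the top factor of
  the denominator.\<close>

lemma gfun_coeff_Suc':
  assumes "Suc i \<le> m"
  shows "(real n + real m) * gfun_coeff m i (Suc n) - real i * gfun_coeff (m - 2) (i - 1) (Suc (Suc n))
    = gfun_coeff m (Suc i) n"
proof (cases "odd (n + i)")
  case True
  let ?q = "dfact (int n + int i) / dfact (int n + int m - int i)"
  have 1: "gfun_coeff m i (Suc n) = ?q"
    using True by (simp add: gfun_coeff_def algebra_simps)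
  have 2: "real i * gfun_coeff (m - 2) (i - 1) (Suc (Suc n)) = real i * ?q"
  proof (cases i)
    case (Suc k)
    have "int (Suc (Suc n)) + int k - 1 = int n + int i"
         "int (Suc (Suc n)) + int (m - 2) - int k - 1 = int n + int m - int i"
      using Suc assms by auto
    then show ?thesis using True Suc by (simp only: gfun_coeff_def) (auto simp: algebra_simps)
  qed simp
  have "dfact (int n + int m - int i) = (real n + real m - real i) * dfact (int n + int m - int i - 2)"
    using assms by (subst dfact_rec) auto
  moreover have "real n + real m - real i \<noteq> 0" using assms by linarith
  moreover have "gfun_coeff m (Suc i) n = dfact (int n + int i) / dfact (int n + int m - int i - 2)"
    using True by (simp add: gfun_coeff_def algebra_simps)
  ultimately have "gfun_coeff m (Suc i) n = (real n + real m - real i) * ?q"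
    by simp
  then show ?thesis unfolding 1 2 by (simp only: left_diff_distrib)
next
  case False
  then show ?thesis
    by (cases i) (auto simp: gfun_coeff_def)
qed

lemma geometric_growth_indicator: "geometric_growth (\<lambda>n. if P n then 0 else 1)"
  by (rule geometric_growthI[of 1 1]) auto

lemma sums_shift2:
  fixes f :: "nat \<Rightarrow> real"
  assumes "f sums S" "f 0 = 0" "f (Suc 0) = 0"
  shows "(\<lambda>n. f (Suc (Suc n))) sums S"
  using assms sums_Suc_iff[of f S] sums_Suc_iff[of "\<lambda>n. f (Suc n)" S] by simp

text \<open>Each given series is split in two and reindexed so that C_n appears throughout. The
  coefficients of the Bessel functions of orders n + lam - 1 and n + lam + 1 then coincide, and the
  Bessel recurrence merges them.\<close>

lemma gfun_expansion_step:
  assumes m: "odd m" "Suc i \<le> m" and z: "z > 0" and w: "\<bar>w\<bar> \<le> 1"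
    and IH1: "gfun_series_term m i z w sums G1"
    and IH2: "i > 0 \<Longrightarrow> gfun_series_term (m - 2) (i - 1) z w sums G2"
  shows "gfun_series_term m (Suc i) z w sums (z * w * G1 + real i * G2)"
proof -
  define lam where "lam = real m / 2"
  define kap where "kap = 2 powr lam * Gamma lam"
  define D where "D = gfun_coeff m i"
  define E where "E = gfun_coeff (m - 2) (i - 1)"
  define D' where "D' = gfun_coeff m (Suc i)"
  define a where "a = bessel_scaled lam z"
  define b where "b = bessel_scaled (lam - 1) z"
  define C where "C = (\<lambda>n. gegenbauer n lam w)"
  note growth = geometric_growth_mult geometric_growth_add geometric_growth_const geometric_growth_of_nat
  have lam: "lam > 0" using m by (simp add: lam_def)
  have b_Suc: "b (Suc n) = z * a n" for n
    using bessel_scaled_Suc[OF z, of "lam - 1" n] by (simp add: a_def b_def)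
  have growth_C: "geometric_growth C"
    unfolding C_def using w lam by (intro geometric_growth_gegenbauer) auto
  have growth_D: "geometric_growth D"
    unfolding D_def using m by (intro geometric_growth_gfun_coeff) auto
  \<comment> \<open>\<open>U\<close> and \<open>V\<close> carry the neighbours C_(n+1) and C_(n-1)
    of w C_n; \<open>P\<close> and \<open>Q\<close> carry C_n and C_(n-2) from the connection
    formula. The indicators remove negative degrees, and \<open>n - 1 - 1\<close> allows two uses of
    \<open>geometric_growth_pred\<close>.\<close>
  define U where "U = (\<lambda>n. kap * z / 2 * D n * (real n + 1) * C (Suc n) * a n)"
  define V where "V = (\<lambda>n. kap * z / 2 * D n * (real n + (2 * lam - 1)) * C (n - 1) * (if n = 0 then 0 else 1) * a n)"
  define P where "P = (\<lambda>n. real i * (kap / 2) * E n * C n * b n)"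
  define Q where "Q = (\<lambda>n. real i * (kap / 2) * E n * C (n - 1 - 1) * (if n < 2 then 0 else 1) * b n)"
  have "summable U"
    unfolding U_def a_def using lam z
    by (intro summable_growth_bessel growth growth_D geometric_growth_Suc[OF growth_C]) auto
  then obtain u where u: "U sums u" by (auto simp: summable_def)
  have "summable V"
    unfolding V_def a_def using lam z
    by (intro summable_growth_bessel growth growth_D geometric_growth_pred[OF growth_C] geometric_growth_indicator) auto
  then obtain v where v: "V sums v" by (auto simp: summable_def)
  have UV: "U n + V n = z * w * gfun_series_term m i z w n" for n
  proof -
    have "U n + V n = kap * z / 2 * D n * a n * ((real n + 1) * C (Suc n) + (if n = 0 then 0 else (real n + 2 * lam - 1) * C (n - 1)))"
      by (simp add: U_def V_def algebra_simps)
    also have "(real n + 1) * C (Suc n) + (if n = 0 then 0 else (real n + 2 * lam - 1) * C (n - 1)) = 2 * (real n + lam) * w * C n"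
    proof (cases n)
      case (Suc k)
      then show ?thesis
        using gegenbauer_rec[of k lam w] by (simp add: C_def algebra_simps)
    qed (simp add: C_def)
    finally have "U n + V n = z * w * (kap * (real n + lam) * D n * a n * C n)"
      by (simp add: algebra_simps)
    then show ?thesis
      by (simp only: gfun_series_term_def kap_def a_def D_def C_def lam_def)
  qed
  have uv: "u + v = z * w * G1"
    using sums_unique2[OF sums_add[OF u v, unfolded UV] sums_mult[OF IH1]] .
  \<comment> \<open>For i > 0 the bound forces m \<ge> 3, so lam - 1 is positive; for i = 0 both
    series are zero.\<close>
  obtain p q where p: "P sums p" and q: "Q sums q" and pq: "p - q = real i * G2"
  proof (cases "i = 0")
    case True
    then show ?thesis
      using that[of 0 0] by (simp add: P_def Q_def)
  next
    case False
    with m have m3: "m \<ge> 3" by (cases "m = 2") auto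
    then have lam1: "lam - 1 > 0" and lam_m: "real (m - 2) / 2 = lam - 1"
      by (auto simp: lam_def of_nat_diff field_simps)
    have growth_E: "geometric_growth E"
      unfolding E_def using m by (intro geometric_growth_gfun_coeff) auto
    have "summable P"
      unfolding P_def b_def using lam1 z
      by (intro summable_growth_bessel growth growth_E growth_C) auto
    then obtain p where p: "P sums p" by (auto simp: summable_def)
    have "summable Q"
      unfolding Q_def b_def using lam1 z
      by (intro summable_growth_bessel growth growth_E geometric_growth_indicator
            geometric_growth_pred[OF geometric_growth_pred[OF growth_C]]) auto
    then obtain q where q: "Q sums q" by (auto simp: summable_def)
    \<comment> \<open>The factor lam - 1 of the connection formula turns Gamma(lam - 1) into
      Gamma(lam).\<close>
    have kap': "2 powr (lam - 1) * Gamma (lam - 1) * (lam - 1) = kap / 2"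
    proof -
      have "Gamma (lam - 1 + 1) = (lam - 1) * Gamma (lam - 1)"
        using lam1 by (intro Gamma_plus1) (auto elim!: nonpos_Ints_cases)
      moreover have "2 powr lam = 2 * 2 powr (lam - 1)"
        by (simp add: powr_diff)
      ultimately show ?thesis by (simp add: kap_def)
    qed
    have PQ: "P n - Q n = real i * gfun_series_term (m - 2) (i - 1) z w n" for n
    proof -
      have connection: "(real n + (lam - 1)) * gegenbauer n (lam - 1) w = (lam - 1) * (C n - (if n < 2 then 0 else 1) * C (n - 1 - 1))"
      proof (cases "n < 2")
        case True
        then show ?thesis using gegenbauer_connection_low[of n "lam - 1" w] by (simp add: C_def)
      next
        case False
        then obtain k where "n = Suc (Suc k)"
          by (metis One_nat_def Suc_1 less_Suc_eq_0_disj not0_implies_Suc not_less_eq)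
        then show ?thesis using gegenbauer_connection[of k "lam - 1" w] by (simp add: C_def algebra_simps)
      qed
      have "gfun_series_term (m - 2) (i - 1) z w n =
         2 powr (lam - 1) * Gamma (lam - 1) * E n * b n * ((real n + (lam - 1)) * gegenbauer n (lam - 1) w)"
        unfolding gfun_series_term_def lam_m E_def b_def by (simp only: mult_ac)
      also have "\<dots> = 2 powr (lam - 1) * Gamma (lam - 1) * E n * b n * ((lam - 1) * (C n - (if n < 2 then 0 else 1) * C (n - 1 - 1)))"
        unfolding connection ..
      also have "\<dots> = (2 powr (lam - 1) * Gamma (lam - 1) * (lam - 1)) * (E n * b n * (C n - (if n < 2 then 0 else 1) * C (n - 1 - 1)))"
        by (simp only: mult_ac)
      finally have "gfun_series_term (m - 2) (i - 1) z w n = kap / 2 * (E n * b n * (C n - (if n < 2 then 0 else 1) * C (n - 1 - 1)))"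
        unfolding kap' .
      then show ?thesis
        unfolding P_def Q_def by (simp only:) (simp add: algebra_simps)
    qed
    have "gfun_series_term (m - 2) (i - 1) z w sums G2"
      using IH2 False by simp
    then have "p - q = real i * G2"
      using sums_unique2[OF sums_diff[OF p q, unfolded PQ] sums_mult] by blast
    with p q that show ?thesis by blast
  qed
  \<comment> \<open>\<open>U'\<close> is \<open>U\<close> moved up by one, since
    \<open>b (Suc n)\<close> is \<open>z * a n\<close>. Below, \<open>V\<close> moves down by one
    and \<open>Q\<close> by two; the terms lost are zero.\<close>
  define U' where "U' = (\<lambda>n. kap / 2 * real n * D (n - 1) * C n * b n)"
  have "U' sums u"
    using sums_Suc[of U' u] u by (simp add: U'_def U_def b_Suc algebra_simps)
  moreover have "(\<lambda>n. V (Suc n)) sums v"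
    using v sums_Suc_iff[of V v] by (simp add: V_def)
  moreover have "(\<lambda>n. Q (Suc (Suc n))) sums q"
    using q by (rule sums_shift2) (auto simp: Q_def)
  ultimately have "(\<lambda>n. U' n + V (Suc n) + (P n - Q (Suc (Suc n)))) sums (u + v + (p - q))"
    using p by (intro sums_add sums_diff)
  moreover have "U' n + V (Suc n) + (P n - Q (Suc (Suc n))) = gfun_series_term m (Suc i) z w n" for n
  proof -
    have D1: "real n * D (n - 1) + real i * E n = D' n"
      unfolding D_def E_def D'_def by (rule gfun_coeff_Suc[OF m(2)])
    have D2: "(real n + 2 * lam) * D (Suc n) - real i * E (Suc (Suc n)) = D' n"
      unfolding D_def E_def D'_def using gfun_coeff_Suc'[OF m(2), of n] by (simp add: lam_def)
    \<comment> \<open>The factor \<open>D' n\<close> covers n = 0, m = 1, where lam - 1 is negative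
      and \<open>bessel_scaled_rec\<close> does not apply: there i = 0 and \<open>D' 0\<close>
      vanishes by parity.\<close>
    have bes: "D' n * (b n + z * a (Suc n)) = D' n * (2 * (real n + lam) * a n)"
    proof (cases n)
      case 0
      show ?thesis
      proof (cases "m \<ge> 3")
        case True
        then have "lam - 1 \<ge> 0" by (simp add: lam_def)
        from bessel_scaled_rec[OF this z, of n] show ?thesis
          by (simp add: a_def b_def)
      next
        case False
        with m have "i = 0" by (cases "m = 2") auto
        with 0 show ?thesis by (simp add: D'_def gfun_coeff_def)
      qed
    next
      case (Suc k)
      have "z * a k + z * a (Suc (Suc k)) = 2 * (real k + lam + 1) * a (Suc k)"
        unfolding a_def bessel_scaled_Suc[OF z, of lam]
        using arg_cong[OF bessel_scaled_rec[of lam z k], of "\<lambda>x. z * x"] lam z by (simp add: algebra_simps)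
      then show ?thesis
        unfolding Suc b_Suc by (simp add: algebra_simps)
    qed
    have "U' n + V (Suc n) + (P n - Q (Suc (Suc n))) =
       kap / 2 * C n * ((real n * D (n - 1) + real i * E n) * b n
          + ((real n + 2 * lam) * D (Suc n) - real i * E (Suc (Suc n))) * (z * a (Suc n)))"
      by (simp add: U'_def V_def P_def Q_def b_Suc algebra_simps)
    also have "\<dots> = kap / 2 * C n * (D' n * (b n + z * a (Suc n)))"
      unfolding D1 D2 by (simp only: distrib_left)
    also have "\<dots> = kap * (real n + lam) * D' n * a n * C n"
      unfolding bes by simp
    also have "\<dots> = gfun_series_term m (Suc i) z w n"
      by (simp only: gfun_series_term_def kap_def C_def D'_def a_def lam_def)
    finally show ?thesis .
  qed
  ultimately show ?thesis
    using uv pq by simp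
qed

text \<open>The induction varies m because the recurrence leads from (m, k + 1) to (m, k) and (m -
  2, k - 1); the bound i \<le> m survives both moves.\<close>

lemma gfun_expansion:
  assumes "odd m" "i \<le> m" "z > 0" "\<bar>w\<bar> \<le> 1"
  shows "gfun_series_term m i z w sums gfun m i (z * w) (z * sqrt (1 - w\<^sup>2))"
  using assms(1,2)
proof (induction i arbitrary: m rule: less_induct)
  case (less i)
  show ?case
  proof (cases i)
    case 0
    then show ?thesis using gfun_0_expansion less.prems assms by simp
  next
    case (Suc k)
    have "gfun_series_term m (Suc k) z w sums
      (z * w * gfun m k (z * w) (z * sqrt (1 - w\<^sup>2)) + real k * gfun (m - 2) (k - 1) (z * w) (z * sqrt (1 - w\<^sup>2)))"
      using less.prems Suc assms(3,4) by (intro gfun_expansion_step less.IH) auto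
    moreover have "k = 0 \<or> m \<ge> 2" using less.prems Suc by auto
    ultimately show ?thesis using Suc by (simp add: gfun_Suc)
  qed
qed

section \<open>Separation by parity and the six expansions\<close>

lemma gfun_expansion_even:
  assumes "odd m" "i \<le> m" "z > 0" "\<bar>w\<bar> \<le> 1" "even i"
  shows "(\<lambda>j. 2 powr (real m / 2) * Gamma (real m / 2) * (2 * real j + real m / 2)
     * (dfact (int (2 * j + i) - 1) / dfact (int (2 * j + m) - int i - 1))
     * (z powr (- (real m / 2)) * besselJ (2 * real j + real m / 2) z) * gegenbauer (2 * j) (real m / 2) w)
   sums gfun m i (z * w) (z * sqrt (1 - w\<^sup>2))"
proof -
  have "(\<lambda>j. gfun_series_term m i z w (2 * j)) sums gfun m i (z * w) (z * sqrt (1 - w\<^sup>2))"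
    using gfun_expansion[OF assms(1-4)] assms(5)
    by (subst sums_even_iff) (auto simp: gfun_series_term_def gfun_coeff_def)
  then show ?thesis
    using assms(5) by (simp add: gfun_series_term_def gfun_coeff_def bessel_scaled_def)
qed

lemma gfun_expansion_odd:
  assumes "odd m" "i \<le> m" "z > 0" "\<bar>w\<bar> \<le> 1" "odd i"
  shows "(\<lambda>j. 2 powr (real m / 2) * Gamma (real m / 2) * (2 * real j + real m / 2 + 1)
     * (dfact (int (2 * j + i)) / dfact (int (2 * j + m) - int i))
     * (z powr (- (real m / 2)) * besselJ (2 * real j + real m / 2 + 1) z) * gegenbauer (2 * j + 1) (real m / 2) w)
   sums gfun m i (z * w) (z * sqrt (1 - w\<^sup>2))"
proof -
  have "(\<lambda>j. gfun_series_term m i z w (2 * j + 1)) sums gfun m i (z * w) (z * sqrt (1 - w\<^sup>2))"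
    using gfun_expansion[OF assms(1-4)] assms(5)
    by (subst sums_odd_iff) (auto simp: gfun_series_term_def gfun_coeff_def)
  moreover have "gfun_coeff m i (2 * j + 1) = dfact (int (2 * j + i)) / dfact (int (2 * j + m) - int i)" for j
  proof -
    have "int (2 * j + 1) + int i - 1 = int (2 * j + i)"
      "int (2 * j + 1) + int m - int i - 1 = int (2 * j + m) - int i"
      by auto
    then show ?thesis using assms(5) unfolding gfun_coeff_def by (simp only:) simp
  qed
  moreover have "real (2 * j + 1) + real m / 2 = 2 * real j + real m / 2 + 1" for j
    by simp
  ultimately show ?thesis
    by (simp only: gfun_series_term_def bessel_scaled_def)
qed

lemma fhat_eq_gfun:
  assumes "m \<ge> 2"
  shows "fhat m i s t = (-1) ^ ((m + 1) div 2 + i) * gfun (m - 2) i s t"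
proof -
  have "real m - 2 * real l - 3 = real (m - 2) - 2 * real l - 1" for l
    using assms by (simp add: of_nat_diff)
  then show ?thesis by (simp only: fhat_def gfun_def)
qed

text \<open>Gamma(i + 1) = i Gamma(i) supplies the factor i, and Gamma(i - 2l) is the denominator
  belonging to i - 1.\<close>

lemma ftilde_eq_gfun:
  assumes "m \<ge> 2"
  shows "ftilde m i s t = - real i * gfun (m - 2) (i - 1) s t"
proof (cases i)
  case (Suc k)
  have a: "real m - 2 * real l - 3 = real (m - 2) - 2 * real l - 1" for l
    using assms by (simp add: of_nat_diff)
  have b: "real (Suc k) - 2 * real l = real k + 1 - 2 * real l" for l
    by simp
  have c: "Gamma (real (Suc k) + 1) = real (Suc k) * Gamma (real k + 1)"
    using Gamma_fact[of k, where 'a = real] Gamma_fact[of "Suc k", where 'a = real] by (simp add: add_ac)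
  have "(\<Sum>l\<le>k div 2. s ^ (k - 2 * l) * (1 / (2 ^ l * fact l))
         * (real (Suc k) * Gamma (real k + 1) / Gamma (real k + 1 - 2 * real l))
         * besselJtilde ((real (m - 2) - 2 * real l - 1) / 2) t) = real (Suc k) * gfun (m - 2) k s t"
    unfolding gfun_def sum_distrib_left by (intro sum.cong refl) (simp del: of_nat_Suc)
  then show ?thesis
    unfolding Suc ftilde_def a b c by (simp del: of_nat_Suc)
qed (simp add: ftilde_def)

theorem theorem5p3:
  fixes m i :: nat and z w :: real
  assumes "odd m" and "m \<ge> 3" and "i \<le> m - 2"
    and "z > 0" and "-1 \<le> w" and "w \<le> 1"
  defines "s \<equiv> z * w" and "t \<equiv> z * sqrt (1 - w\<^sup>2)"
  shows
   "(even i \<longrightarrow>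
      ((\<lambda>j. - real i * 2 powr (real m / 2 - 2) * Gamma (real m / 2 - 1)
             * ((4 * real j + real m) * dfact (int (2*j+i) - 1) / dfact (int (2*j+m) - int i - 1)
             * z powr (1 - real m / 2) * besselJ (2 * real j + real m / 2) z
             * gegenbauer (2*j+1) (real m / 2 - 1) w))
        sums ftilde m i s t)
    \<and> ((\<lambda>j. (-1) ^ ((m+1) div 2) * 2 powr (real m / 2 - 1) * Gamma (real m / 2 - 1)
             * ((2 * real j + real m / 2 - 1) * dfact (int (2*j+i) - 1) / dfact (int (2*j+m) - int i - 3)
             * z powr (1 - real m / 2) * besselJ (2 * real j + real m / 2 - 1) z
             * gegenbauer (2*j) (real m / 2 - 1) w))
        sums fhat m i s t)
    \<and> ((\<lambda>j. 2 powr (real m / 2 - 1) * Gamma (real m / 2)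
             * ((4 * real j + real m) * dfact (int (2*j+i) - 1) / dfact (int (2*j+m) - int i - 1)
             * z powr (- real m / 2) * besselJ (2 * real j + real m / 2) z
             * gegenbauer (2*j) (real m / 2) w))
        sums gfun m i s t))
  \<and> (odd i \<longrightarrow>
      ((\<lambda>j. - real i * 2 powr (real m / 2 - 2) * Gamma (real m / 2 - 1)
             * ((4 * real j + real m - 2) * dfact (int (2*j+i) - 2) / dfact (int (2*j+m) - int i - 2)
             * z powr (1 - real m / 2) * besselJ (2 * real j + real m / 2 - 1) z
             * gegenbauer (2*j) (real m / 2 - 1) w))
        sums ftilde m i s t)
    \<and> ((\<lambda>j. - ((-1) ^ ((m+1) div 2)) * 2 powr (real m / 2 - 1) * Gamma (real m / 2 - 1)
             * ((2 * real j + real m / 2) * dfact (int (2*j+i)) / dfact (int (2*j+m) - int i - 2)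
             * z powr (1 - real m / 2) * besselJ (2 * real j + real m / 2) z
             * gegenbauer (2*j+1) (real m / 2 - 1) w))
        sums fhat m i s t)
    \<and> ((\<lambda>j. 2 powr (real m / 2 - 1) * Gamma (real m / 2)
             * ((4 * real j + real m + 2) * dfact (int (2*j+i)) / dfact (int (2*j+m) - int i)
             * z powr (- real m / 2) * besselJ (2 * real j + real m / 2 + 1) z
             * gegenbauer (2*j+1) (real m / 2) w))
        sums gfun m i s t))"
proof -
  have w: "\<bar>w\<bar> \<le> 1" and z: "z > 0" using assms by auto
  have m: "odd m" "odd (m - 2)" "m \<ge> 2" using assms by auto
  have h: "real (m - 2) / 2 = real m / 2 - 1"
    using assms by (simp add: of_nat_diff field_simps)
  have p: "2 powr (real m / 2) = 2 * 2 powr (real m / 2 - 1)"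
          "2 powr (real m / 2 - 1) = 2 * 2 powr (real m / 2 - 2)"
    using powr_add[of 2 1 "real m / 2 - 1"] powr_add[of 2 1 "real m / 2 - 2"] by simp_all
  have arg: "- (real m / 2 - 1) = 1 - real m / 2" "- (real m / 2) = - real m / 2"
     "\<And>j. 2 * real j + (real m / 2 - 1) = 2 * real j + real m / 2 - 1"
     "\<And>j. 2 * real j + real m / 2 - 1 + 1 = 2 * real j + real m / 2"
    by simp_all
  \<comment> \<open>Only the sign or factor c, the power of 2 and the linear factor X differ between
    the two forms, for instance 2^(m/2) (2j + m/2) = 2^(m/2-1) (4j + m).\<close>
  have rescale: "c * (K * G * X * (A / B) * (Z * J) * C) = c' * K' * G * (X' * A / B * Z * J * C)"
    if "c * (K * X) = c' * (K' * X')" for c c' K K' G X X' A B Z J C :: real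
  proof -
    have "c * (K * G * X * (A / B) * (Z * J) * C) = (c * (K * X)) * (G * (A / B) * (Z * J) * C)"
      by (simp only: mult_ac)
    then show ?thesis
      unfolding that by (simp only: mult_ac times_divide_eq_right)
  qed
  have rescale1: "K * G * X * (A / B) * (Z * J) * C = K' * G * (X' * A / B * Z * J * C)"
    if "K * X = K' * X'" for K K' G X X' A B Z J C :: real
    using rescale[of 1 K X 1 K' X'] that by simp
  show ?thesis
    unfolding s_def t_def
  proof (intro conjI impI)
    assume "even i"
    show "(\<lambda>j. 2 powr (real m / 2 - 1) * Gamma (real m / 2)
             * ((4 * real j + real m) * dfact (int (2*j+i) - 1) / dfact (int (2*j+m) - int i - 1)
             * z powr (- real m / 2) * besselJ (2 * real j + real m / 2) z
             * gegenbauer (2*j) (real m / 2) w))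
        sums gfun m i (z * w) (z * sqrt (1 - w\<^sup>2))"
      by (rule sums_cong[THEN iffD1, OF _ gfun_expansion_even[OF m(1) _ z w \<open>even i\<close>, unfolded arg]], rule rescale1)
         (use assms(3) in \<open>simp_all add: p(1) algebra_simps\<close>)
  next
    assume "even i"
    have d: "int (2 * j + (m - 2)) - int i - 1 = int (2*j+m) - int i - 3" for j
      using m by simp
    show "(\<lambda>j. (-1) ^ ((m+1) div 2) * 2 powr (real m / 2 - 1) * Gamma (real m / 2 - 1)
             * ((2 * real j + real m / 2 - 1) * dfact (int (2*j+i) - 1) / dfact (int (2*j+m) - int i - 3)
             * z powr (1 - real m / 2) * besselJ (2 * real j + real m / 2 - 1) z
             * gegenbauer (2*j) (real m / 2 - 1) w))
        sums fhat m i (z * w) (z * sqrt (1 - w\<^sup>2))"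
      unfolding fhat_eq_gfun[OF m(3)]
      by (rule sums_cong[THEN iffD1, OF _ sums_mult[OF gfun_expansion_even[OF m(2) _ z w \<open>even i\<close>, unfolded h d arg]]], rule rescale)
         (use assms(3) in \<open>simp_all add: power_add \<open>even i\<close> algebra_simps\<close>)
  next
    assume "odd i"
    show "(\<lambda>j. 2 powr (real m / 2 - 1) * Gamma (real m / 2)
             * ((4 * real j + real m + 2) * dfact (int (2*j+i)) / dfact (int (2*j+m) - int i)
             * z powr (- real m / 2) * besselJ (2 * real j + real m / 2 + 1) z
             * gegenbauer (2*j+1) (real m / 2) w))
        sums gfun m i (z * w) (z * sqrt (1 - w\<^sup>2))"
      by (rule sums_cong[THEN iffD1, OF _ gfun_expansion_odd[OF m(1) _ z w \<open>odd i\<close>, unfolded arg]], rule rescale1)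
         (use assms(3) in \<open>simp_all add: p(1) algebra_simps\<close>)
  next
    assume "odd i"
    have d: "int (2 * j + (m - 2)) - int i = int (2*j+m) - int i - 2" for j
      using m by simp
    show "(\<lambda>j. - ((-1) ^ ((m+1) div 2)) * 2 powr (real m / 2 - 1) * Gamma (real m / 2 - 1)
             * ((2 * real j + real m / 2) * dfact (int (2*j+i)) / dfact (int (2*j+m) - int i - 2)
             * z powr (1 - real m / 2) * besselJ (2 * real j + real m / 2) z
             * gegenbauer (2*j+1) (real m / 2 - 1) w))
        sums fhat m i (z * w) (z * sqrt (1 - w\<^sup>2))"
      unfolding fhat_eq_gfun[OF m(3)]
      by (rule sums_cong[THEN iffD1, OF _ sums_mult[OF gfun_expansion_odd[OF m(2) _ z w \<open>odd i\<close>, unfolded h d arg]]], rule rescale)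
         (use assms(3) in \<open>simp_all add: power_add \<open>odd i\<close> algebra_simps\<close>)
  next
    assume "odd i"
    \<comment> \<open>For \<open>ftilde\<close> the parity flips: the odd case uses the even-degree
      expansion at i - 1.\<close>
    then have i: "even (i - 1)" "i > 0" by (auto elim: oddE)
    have d: "int (2 * j + (m - 2)) - int (i - 1) - 1 = int (2*j+m) - int i - 2"
            "int (2 * j + (i - 1)) - 1 = int (2 * j + i) - 2" for j
      using m i by auto
    show "(\<lambda>j. - real i * 2 powr (real m / 2 - 2) * Gamma (real m / 2 - 1)
             * ((4 * real j + real m - 2) * dfact (int (2*j+i) - 2) / dfact (int (2*j+m) - int i - 2)
             * z powr (1 - real m / 2) * besselJ (2 * real j + real m / 2 - 1) z
             * gegenbauer (2*j) (real m / 2 - 1) w))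
        sums ftilde m i (z * w) (z * sqrt (1 - w\<^sup>2))"
      unfolding ftilde_eq_gfun[OF m(3)]
      by (rule sums_cong[THEN iffD1, OF _ sums_mult[OF gfun_expansion_even[OF m(2) _ z w i(1), unfolded h d arg]]], rule rescale)
         (use assms(3) in \<open>simp_all add: p(2) algebra_simps\<close>)
  next
    assume "even i"
    show "(\<lambda>j. - real i * 2 powr (real m / 2 - 2) * Gamma (real m / 2 - 1)
             * ((4 * real j + real m) * dfact (int (2*j+i) - 1) / dfact (int (2*j+m) - int i - 1)
             * z powr (1 - real m / 2) * besselJ (2 * real j + real m / 2) z
             * gegenbauer (2*j+1) (real m / 2 - 1) w))
        sums ftilde m i (z * w) (z * sqrt (1 - w\<^sup>2))"
    \<comment> \<open>At i = 0 the truncated i - 1 would be even, so this case is separate; both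
      sides are zero.\<close>
    proof (cases "i = 0")
      case True
      then show ?thesis by (simp add: ftilde_def)
    next
      case False
      with \<open>even i\<close> have i: "odd (i - 1)" "i > 0" by auto
      have d: "int (2 * j + (m - 2)) - int (i - 1) = int (2*j+m) - int i - 1"
              "int (2 * j + (i - 1)) = int (2 * j + i) - 1" for j
        using m i by auto
      show ?thesis
        unfolding ftilde_eq_gfun[OF m(3)]
        by (rule sums_cong[THEN iffD1, OF _ sums_mult[OF gfun_expansion_odd[OF m(2) _ z w i(1), unfolded h d arg]]], rule rescale)
         (use assms(3) in \<open>simp_all add: p(2) algebra_simps\<close>)
    qed
  qed
qed

end
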